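(* Let $\mathcal{P}$ and $\mathcal{Q}$ be finite chiral or directly regular $n$-polytopes. Let $g_1=\gcd(|X(\mathcal{P})|,|\Gamma^+(\mathcal{Q})|)$ and $g_2=\gcd(|X(\mathcal{Q})|,|\Gamma^+(\mathcal{P})|)$. Then $|X(\mathcal{P}\diamond\mathcal{Q})|$ is divisible by $|X(\mathcal{P})|/g_1$ and by $|X(\mathcal{Q})|/g_2$.
   Context: All polytopes are abstract polytopes. A regular polytope is directly regular if its rotation group $\Gamma^+(\mathcal{P})$, generated by $\sigma_i=\rho_{i-1}\rho_i$ ($\rho_0,\dots,\rho_{n-1}$ the standard generating involutions relative to a base flag), has index $2$ in the automorphism group. A polytope is chiral if its automorphism group has two orbits on flags, adjacent flags lying in distinct orbits; then $\Gamma^+(\mathcal{P})$ is the full automorphism group, generated by standard rotations $\sigma_1,\dots,\sigma_{n-1}$. Let $W^+=\langle \sigma_1,\dots,\sigma_{n-1}\mid (\sigma_i\cdots\sigma_j)^2=1,\ 1\le i<j\le n-1\rangle$; each such $\Gamma^+(\mathcal{P})$ equals $W^+/M$ for a normal subgroup $M$, generators corresponding. Let $w\mapsto\overline{w}$ be the automorphism of $W^+$ with $\sigma_1\mapsto\sigma_1^{-1}$, $\sigma_2\mapsto\sigma_1^2\sigma_2$, $\sigma_j\mapsto\sigma_j$ ($j\ge3$). Mix: if $\Gamma^+(\mathcal{P})=W^+/M$ and $\Gamma^+(\mathcal{Q})=W^+/K$, the mix $\mathcal{P}\diamond\mathcal{Q}$ is the (flag-connected pre-)polytope whose rotation group is the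 subgroup of $\Gamma^+(\mathcal{P})\times\Gamma^+(\mathcal{Q})$ generated by $(\sigma_i,\sigma_i')$, isomorphic to $W^+/(M\cap K)$. Chirality group: for any (pre-)polytope with rotation group $W^+/N$, $X=N\overline{N}/N$, the kernel of the natural epimorphism $W^+/N\to W^+/(N\overline N)$ (isomorphic to $N/(N\cap\overline N)$). *)

theory Defs
  imports "HOL-Algebra.Coset" "HOL-Algebra.Bij" "HOL-Algebra.Generated_Groups"
begin

section \<open>Abstract polytopes\<close>

text \<open>A poset is a reflexive relation \<open>r\<close>; its set of faces is \<open>Field r\<close>, and \<open>(x, y) \<in> r\<close> means
  \<open>x \<le> y\<close>. The improper faces of ranks \<open>-1\<close> and \<open>n\<close> belong to a polytope.\<close>

definition flags :: "'a rel \<Rightarrow> 'a set set" where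
  "flags r = {C \<in> Chains r. \<forall>D \<in> Chains r. C \<subseteq> D \<longrightarrow> D = C}"

definition adjacent :: "'a set \<Rightarrow> 'a set \<Rightarrow> bool" where
  "adjacent \<Phi> \<Psi> \<longleftrightarrow> card (\<Phi> - \<Psi>) = 1 \<and> card (\<Psi> - \<Phi>) = 1"

definition flag_connected :: "'a rel \<Rightarrow> bool" where
  "flag_connected r \<longleftrightarrow> (\<forall>\<Phi> \<in> flags r. \<forall>\<Psi> \<in> flags r.
     (\<Phi>, \<Psi>) \<in> {(A, B). A \<in> flags r \<and> B \<in> flags r \<and> adjacent A B}\<^sup>*)"

definition section_between :: "'a rel \<Rightarrow> 'a \<Rightarrow> 'a \<Rightarrow> 'a rel" where
  "section_between r x y = Restr r {z. (x, z) \<in> r \<and> (z, y) \<in> r}"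

text \<open>The rank of \<open>x\<close> is the rank of the section of all faces below \<open>x\<close>, i.e. the number of elements
  of a flag of that section minus 2. In a polytope all these flags have the same size.\<close>

definition face_rank :: "'a rel \<Rightarrow> 'a \<Rightarrow> int" where
  "face_rank r x = int (card (SOME C. C \<in> flags (Restr r {z. (z, x) \<in> r}))) - 2"

definition abstract_polytope :: "nat \<Rightarrow> 'a rel \<Rightarrow> bool" where
  "abstract_polytope n r \<longleftrightarrow>
     Partial_order r \<and>
     (\<exists>b \<in> Field r. \<forall>x \<in> Field r. (b, x) \<in> r) \<and>
     (\<exists>t \<in> Field r. \<forall>x \<in> Field r. (x, t) \<in> r) \<and>
     (\<forall>\<Phi> \<in> flags r. card \<Phi> = n + 2) \<and>
     (\<forall>x y. (x, y) \<in> r \<longrightarrow> flag_connected (section_between r x y)) \<and>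
     (\<forall>x y. (x, y) \<in> r \<and> face_rank r y = face_rank r x + 2 \<longrightarrow>
        card {z. (x, z) \<in> r \<and> (z, y) \<in> r \<and> z \<noteq> x \<and> z \<noteq> y} = 2)"

definition adj_flag :: "'a rel \<Rightarrow> nat \<Rightarrow> 'a set \<Rightarrow> 'a set" where
  "adj_flag r i \<Phi> =
     (THE \<Psi>. \<Psi> \<in> flags r \<and> adjacent \<Phi> \<Psi> \<and> (\<forall>x \<in> \<Phi> - \<Psi>. face_rank r x = int i))"


section \<open>Automorphisms, regularity and chirality\<close>

text \<open>Automorphisms act on the left: the product in \<open>BijGroup\<close> is composition.\<close>

definition aut_group :: "'a rel \<Rightarrow> ('a \<Rightarrow> 'a) monoid" where
  "aut_group r = BijGroup (Field r)
     \<lparr>carrier := {f \<in> Bij (Field r).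
        \<forall>x \<in> Field r. \<forall>y \<in> Field r. (x, y) \<in> r \<longleftrightarrow> (f x, f y) \<in> r}\<rparr>"

definition flag_orbit_rel :: "'a rel \<Rightarrow> 'a set rel" where
  "flag_orbit_rel r =
     {(\<Phi>, \<Psi>). \<Phi> \<in> flags r \<and> \<Psi> \<in> flags r \<and> (\<exists>f \<in> carrier (aut_group r). f ` \<Phi> = \<Psi>)}"

definition regular :: "'a rel \<Rightarrow> bool" where
  "regular r \<longleftrightarrow> (\<forall>\<Phi> \<in> flags r. \<forall>\<Psi> \<in> flags r. (\<Phi>, \<Psi>) \<in> flag_orbit_rel r)"

definition chiral :: "'a rel \<Rightarrow> bool" where
  "chiral r \<longleftrightarrow> card (flags r // flag_orbit_rel r) = 2 \<and>
     (\<forall>\<Phi> \<in> flags r. \<forall>\<Psi> \<in> flags r. adjacent \<Phi> \<Psi> \<longrightarrow> (\<Phi>, \<Psi>) \<notin> flag_orbit_rel r)"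

definition aut_moving :: "'a rel \<Rightarrow> 'a set \<Rightarrow> 'a set \<Rightarrow> 'a \<Rightarrow> 'a" where
  "aut_moving r \<Phi> \<Psi> = (THE f. f \<in> carrier (aut_group r) \<and> f ` \<Phi> = \<Psi>)"

definition reflection :: "'a rel \<Rightarrow> 'a set \<Rightarrow> nat \<Rightarrow> 'a \<Rightarrow> 'a" where
  "reflection r \<Phi> i = aut_moving r \<Phi> (adj_flag r i \<Phi>)"

text \<open>The standard rotation \<open>\<sigma>\<^sub>i\<close> (for \<open>1 \<le> i < n\<close>) relative to the base flag \<open>\<Phi>\<close>. For regular \<open>r\<close> the product
  \<open>\<rho>\<^sub>i\<^sub>-\<^sub>1 \<rho>\<^sub>i\<close> maps \<open>\<Phi>\<close> to the \<open>i\<close>-adjacent flag of the \<open>(i-1)\<close>-adjacent flag of \<open>\<Phi>\<close>, because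
  automorphisms commute with taking adjacent flags. In the chiral case, where the \<open>\<rho>\<^sub>i\<close> do not
  exist, \<open>\<sigma>\<^sub>i\<close> is the automorphism with this effect on \<open>\<Phi>\<close>.\<close>

definition rotation :: "'a rel \<Rightarrow> 'a set \<Rightarrow> nat \<Rightarrow> 'a \<Rightarrow> 'a" where
  "rotation r \<Phi> i =
     (if regular r then reflection r \<Phi> (i - 1) \<otimes>\<^bsub>aut_group r\<^esub> reflection r \<Phi> i
      else aut_moving r \<Phi> (adj_flag r i (adj_flag r (i - 1) \<Phi>)))"

definition rotation_group :: "nat \<Rightarrow> 'a rel \<Rightarrow> 'a set \<Rightarrow> ('a \<Rightarrow> 'a) monoid" where
  "rotation_group n r \<Phi> =
     (aut_group r)\<lparr>carrier := generate (aut_group r) (rotation r \<Phi> ` {1..<n})\<rparr>"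

definition directly_regular :: "nat \<Rightarrow> 'a rel \<Rightarrow> 'a set \<Rightarrow> bool" where
  "directly_regular n r \<Phi> \<longleftrightarrow>
     regular r \<and> card (rcosets\<^bsub>aut_group r\<^esub> (carrier (rotation_group n r \<Phi>))) = 2"


section \<open>Groups given by generators and relators\<close>

text \<open>A letter \<open>(i, b)\<close> stands for the generator \<open>i\<close> if \<open>b\<close> holds and for its inverse otherwise.\<close>

type_synonym 'i word = "('i \<times> bool) list"

inductive_set word_cong :: "'i set \<Rightarrow> 'i word set \<Rightarrow> 'i word rel" for S R where
  refl: "w \<in> lists (S \<times> UNIV) \<Longrightarrow> (w, w) \<in> word_cong S R"
| sym: "(v, w) \<in> word_cong S R \<Longrightarrow> (w, v) \<in> word_cong S R"
| trans: "(u, v) \<in> word_cong S R \<Longrightarrow> (v, w) \<in> word_cong S R \<Longrightarrow> (u, w) \<in> word_cong S R"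
| cancel: "u \<in> lists (S \<times> UNIV) \<Longrightarrow> v \<in> lists (S \<times> UNIV) \<Longrightarrow> i \<in> S \<Longrightarrow>
    (u @ [(i, b), (i, \<not> b)] @ v, u @ v) \<in> word_cong S R"
| relator: "u \<in> lists (S \<times> UNIV) \<Longrightarrow> v \<in> lists (S \<times> UNIV) \<Longrightarrow> w \<in> R \<Longrightarrow> w \<in> lists (S \<times> UNIV) \<Longrightarrow>
    (u @ w @ v, u @ v) \<in> word_cong S R"

definition presented_group :: "'i set \<Rightarrow> 'i word set \<Rightarrow> 'i word set monoid" where
  "presented_group S R =
     \<lparr>carrier = lists (S \<times> UNIV) // word_cong S R,
      mult = (\<lambda>A B. word_cong S R `` {u @ v | u v. u \<in> A \<and> v \<in> B}),
      one = word_cong S R `` {[]}\<rparr>"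

definition word_eval :: "('g, 'm) monoid_scheme \<Rightarrow> ('i \<Rightarrow> 'g) \<Rightarrow> 'i word \<Rightarrow> 'g" where
  "word_eval G s w =
     foldr (\<lambda>(i, b) x. (if b then s i else inv\<^bsub>G\<^esub> s i) \<otimes>\<^bsub>G\<^esub> x) w \<one>\<^bsub>G\<^esub>"

text \<open>The homomorphism from a presented group to \<open>G\<close> that sends generator \<open>i\<close> to \<open>s i\<close>. It is well
  defined (all words in a class \<open>x\<close> have the same value) when the \<open>s i\<close> satisfy the relators.\<close>

definition induced_hom :: "('g, 'm) monoid_scheme \<Rightarrow> ('i \<Rightarrow> 'g) \<Rightarrow> 'i word set \<Rightarrow> 'g" where
  "induced_hom G s x = the_elem (word_eval G s ` x)"


section \<open>The group \<open>W\<^sup>+\<close>, chirality groups and mixing\<close>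

definition Wplus_relators :: "nat \<Rightarrow> nat word set" where
  "Wplus_relators n =
     {w @ w | w i j. 1 \<le> i \<and> i < j \<and> j < n \<and> w = map (\<lambda>k. (k, True)) [i..<Suc j]}"

definition Wplus :: "nat \<Rightarrow> nat word set monoid" where
  "Wplus n = presented_group {1..<n} (Wplus_relators n)"

definition Wplus_gen :: "nat \<Rightarrow> nat \<Rightarrow> nat word set" where
  "Wplus_gen n i = word_cong {1..<n} (Wplus_relators n) `` {[(i, True)]}"

definition Wplus_bar :: "nat \<Rightarrow> nat word set \<Rightarrow> nat word set" where
  "Wplus_bar n = induced_hom (Wplus n)
     (\<lambda>i. if i = 1 then inv\<^bsub>Wplus n\<^esub> Wplus_gen n 1
          else if i = 2 then Wplus_gen n 1 [^]\<^bsub>Wplus n\<^esub> (2::nat) \<otimes>\<^bsub>Wplus n\<^esub> Wplus_gen n 2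
          else Wplus_gen n i)"

text \<open>A rotation group together with its standard generators (those with index in \<open>{1..<n}\<close>). The
  mix of two polytopes and the chirality group of a (pre-)polytope depend on these data only.\<close>

type_synonym 'g marked_group = "'g monoid \<times> (nat \<Rightarrow> 'g)"

definition rotations :: "nat \<Rightarrow> 'a rel \<Rightarrow> 'a set \<Rightarrow> ('a \<Rightarrow> 'a) marked_group" where
  "rotations n r \<Phi> = (rotation_group n r \<Phi>, rotation r \<Phi>)"

definition mix :: "nat \<Rightarrow> 'g marked_group \<Rightarrow> 'h marked_group \<Rightarrow> ('g \<times> 'h) marked_group" where
  "mix n A B =
     (let D = fst A \<times>\<times> fst B; s = (\<lambda>i. (snd A i, snd B i))
      in (D\<lparr>carrier := generate D (s ` {1..<n})\<rparr>, s))"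

text \<open>The normal subgroup \<open>N\<close> of \<open>W\<^sup>+\<close> such that the given marked group is \<open>W\<^sup>+/N\<close>, generators
  corresponding.\<close>

definition relation_subgroup :: "nat \<Rightarrow> 'g marked_group \<Rightarrow> nat word set set" where
  "relation_subgroup n A = kernel (Wplus n) (fst A) (induced_hom (fst A) (snd A))"

definition chirality_group :: "nat \<Rightarrow> 'g marked_group \<Rightarrow> nat word set set monoid" where
  "chirality_group n A =
     (let N = relation_subgroup n A
      in (Wplus n)\<lparr>carrier := N <#>\<^bsub>Wplus n\<^esub> (Wplus_bar n ` N)\<rparr> Mod N)"

end

theory Submission
  imports Defs
begin

text \<open>Write \<open>\<Gamma>\<^sup>+(P) = W\<^sup>+/M\<close> and \<open>\<Gamma>\<^sup>+(Q) = W\<^sup>+/K\<close>, with projections \<open>h\<close> and \<open>k\<close>, let \<open>\<beta>\<close> be the bar map,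
  and put \<open>N = M \<inter> K\<close>, so that the mix has rotation group \<open>W\<^sup>+/N\<close>. Then \<open>X(P)\<close> has the order of
  \<open>h(\<beta>(M))\<close>, and the order of \<open>h(\<beta>(N))\<close> divides that of \<open>X(P \<diamond> Q)\<close>. The image of \<open>M\<close> under
  \<open>x \<mapsto> (h(\<beta>(x)), k(x))\<close> projects onto \<open>h(\<beta>(M))\<close> and onto \<open>k(M)\<close>, the second projection having kernel
  \<open>h(\<beta>(N))\<close>. Hence \<open>|X(P)|\<close> divides \<open>|k(M)| |h(\<beta>(N))|\<close> and so \<open>|\<Gamma>\<^sup>+(Q)| |X(P \<diamond> Q)|\<close>.

  That the standard rotations satisfy the relations of \<open>W\<^sup>+\<close> rests on two facts: an automorphism is
  determined by the image of one flag, and \<open>\<sigma>\<^sub>i \<dots> \<sigma>\<^sub>j\<close> takes the base flag to the \<open>j\<close>-adjacent flag of its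
  \<open>(i-1)\<close>-adjacent flag, where passing to the \<open>j\<close>- and to the \<open>(i-1)\<close>-adjacent flag are commuting
  involutions.\<close>

section \<open>Homomorphic images and their orders\<close>

lemma hom_restrict_carrier:
  assumes "f \<in> hom G H" and "S \<subseteq> carrier G"
  shows "f \<in> hom (G\<lparr>carrier := S\<rparr>) H"
  using assms by (auto simp: hom_def)

text \<open>The first isomorphism theorem combined with Lagrange. Since \<open>card\<close> is 0 on
  infinite sets, the equation also holds for infinite groups.\<close>

lemma (in group_hom) order_eq_card_image_kernel:
  "order G = card (h ` carrier G) * card (kernel G H h)"
proof -
  let ?I = "H\<lparr>carrier := h ` carrier G\<rparr>"
  \<comment> \<open>The isomorphism theorem wants a surjective map, so the codomain is cut down to
    the image.\<close>
  have "group ?I"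
    by (simp add: H.subgroup_imp_group img_is_subgroup)
  moreover have "h \<in> hom G ?I"
    using homh by (auto simp: hom_def)
  ultimately interpret I: group_hom G ?I h
    by (simp add: group_hom_def group_hom_axioms_def)
  have ker: "kernel G ?I h = kernel G H h"
    by (simp add: kernel_def)
  have "(\<lambda>X. the_elem (h ` X)) \<in> iso (G Mod kernel G ?I h) ?I"
    by (rule I.FactGroup_iso_set) simp
  then have "card (carrier (G Mod kernel G H h)) = card (h ` carrier G)"
    unfolding ker iso_def using bij_betw_same_card by fastforce
  then show ?thesis
    using G.lagrange[OF subgroup_kernel] by (simp add: FactGroup_def)
qed

text \<open>The inclusion of kernels lets \<open>g\<close> factor through \<open>f\<close>, so the
  image of \<open>g\<close> is a homomorphic image of the image of \<open>f\<close>.\<close>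

lemma card_image_dvd_of_kernel_subset:
  assumes f: "group_hom G H f" and g: "group_hom G H' g"
    and sub: "kernel G H f \<subseteq> kernel G H' g"
  shows "card (g ` carrier G) dvd card (f ` carrier G)"
proof -
  interpret f: group_hom G H f by (rule f)
  interpret g: group_hom G H' g by (rule g)
  let ?I = "H\<lparr>carrier := f ` carrier G\<rparr>"
  \<comment> \<open>Any preimage would do: two preimages under \<open>f\<close> differ by an element
    of the kernel of \<open>f\<close>, which \<open>g\<close> also kills.\<close>
  define \<theta> where "\<theta> y = g (inv_into (carrier G) f y)" for y
  have theta: "\<theta> (f x) = g x" if x: "x \<in> carrier G" for x
  proof -
    let ?y = "inv_into (carrier G) f (f x)"
    have y: "?y \<in> carrier G" "f ?y = f x"
      using x by (auto intro: inv_into_into f_inv_into_f)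
    then have "?y \<otimes>\<^bsub>G\<^esub> inv\<^bsub>G\<^esub> x \<in> kernel G H f"
      using x by (simp add: kernel_def)
    then have "g (?y \<otimes>\<^bsub>G\<^esub> inv\<^bsub>G\<^esub> x) = \<one>\<^bsub>H'\<^esub>"
      using sub by (auto simp: kernel_def)
    then show ?thesis
      using x y g.H.inv_solve_right' unfolding \<theta>_def by fastforce
  qed
  have "\<theta> \<in> hom ?I H'"
  proof (rule homI)
    fix u v assume "u \<in> carrier ?I" "v \<in> carrier ?I"
    then obtain x y where "x \<in> carrier G" "y \<in> carrier G" "u = f x" "v = f y" by auto
    then show "\<theta> (u \<otimes>\<^bsub>?I\<^esub> v) = \<theta> u \<otimes>\<^bsub>H'\<^esub> \<theta> v"
      by (simp add: theta flip: f.hom_mult)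
  qed (auto simp: theta)
  then interpret t: group_hom ?I H' \<theta>
    by (simp add: group_hom_def group_hom_axioms_def f.H.subgroup_imp_group f.img_is_subgroup
        g.H.is_group)
  have "\<theta> ` f ` carrier G = g ` carrier G"
    by (simp add: image_image theta)
  then show ?thesis
    using t.order_eq_card_image_kernel by (simp add: order_def)
qed

lemma (in group_hom) card_image_subgroup_dvd_order:
  assumes "subgroup S G"
  shows "card (h ` S) dvd order H"
  using H.lagrange[OF subgroup_img_is_subgroup[OF assms]] by (metis dvd_triv_right)

text \<open>Dividing \<open>a\<close> and \<open>q\<close> by their gcd leaves coprime numbers, so
  what remains of \<open>a\<close> has to divide \<open>b\<close>.\<close>

lemma dvd_div_gcd_of_dvd_mult:
  fixes a b q :: nat
  assumes "a dvd q * b" and "a > 0"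
  shows "a div gcd a q dvd b"
proof -
  let ?d = "gcd a q"
  have "?d * (a div ?d) dvd ?d * (q div ?d * b)"
    using assms by (simp flip: mult.assoc)
  then have "a div ?d dvd q div ?d * b"
    using assms(2) by (simp only: nat_mult_dvd_cancel_disj) simp
  moreover have "coprime (a div ?d) (q div ?d)"
    using assms(2) by (intro div_gcd_coprime) simp
  ultimately show ?thesis
    by (simp add: coprime_dvd_mult_right_iff)
qed

section \<open>Chirality groups counted through homomorphic images\<close>

text \<open>Every coset of \<open>L\<close> inside \<open>L <#> B\<close> has a representative in
  \<open>B\<close>. This is a pure count of cosets, so \<open>B\<close> may be any subset.\<close>

lemma (in group) order_set_mult_Mod:
  assumes "L \<lhd> G" and "B \<subseteq> carrier G"
  shows "order (G\<lparr>carrier := L <#> B\<rparr> Mod L) = card ((#>) L ` B)"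
proof -
  interpret L: normal L G by fact
  have "rcosets\<^bsub>G\<lparr>carrier := L <#> B\<rparr>\<^esub> L = (#>) L ` (L <#> B)"
    by (auto simp: RCOSETS_def r_coset_def)
  also have "\<dots> = (#>) L ` B"
  proof -
    have "L #> (l \<otimes> b) = L #> b" if "l \<in> L" "b \<in> B" for l b
    proof -
      have "L #> (l \<otimes> b) = (L #> l) #> b"
        using that assms(2) L.subset coset_mult_assoc[of L l b] by auto
      moreover have "L #> l = L"
        using that L.subset coset_join2[OF _ L.is_subgroup, of l] by blast
      ultimately show ?thesis by simp
    qed
    then have "(#>) L ` (L <#> B) \<subseteq> (#>) L ` B"
      unfolding set_mult_def by force
    moreover have "b \<in> L <#> B" if "b \<in> B" for b
    proof -
      have "\<one> \<otimes> b \<in> L <#> B"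
        using that L.one_closed unfolding set_mult_def by blast
      then show ?thesis using that assms(2) by auto
    qed
    then have "(#>) L ` B \<subseteq> (#>) L ` (L <#> B)" by (intro image_mono subsetI)
    ultimately show ?thesis by (rule equalityI)
  qed
  finally show ?thesis
    by (simp add: order_def FactGroup_def)
qed

lemma (in group) rcos_eq_iff_hom_eq:
  assumes "group_hom G H h" "x \<in> carrier G" "y \<in> carrier G"
  shows "kernel G H h #> x = kernel G H h #> y \<longleftrightarrow> h x = h y"
proof -
  interpret h: group_hom G H h by fact
  have "kernel G H h #> x = kernel G H h #> y \<longleftrightarrow> x \<otimes> inv y \<in> kernel G H h"
    using assms(2,3) h.subgroup_kernel
    by (metis coset_join1 coset_join2 coset_mult_inv1 coset_mult_inv2 h.subgroup_kernel inv_closed m_closed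
        subgroup.subset)
  also have "\<dots> \<longleftrightarrow> h x = h y"
    using assms(2,3) h.H.inv_solve_right'[of "\<one>\<^bsub>H\<^esub>" "h x" "h y"]
    by (auto simp: kernel_def)
  finally show ?thesis .
qed

text \<open>Cosets of \<open>N\<close> are fibres of \<open>h\<close>, so counting cosets with
  representatives in the image of \<open>N\<close> under \<open>\<beta>\<close> is counting values
  of \<open>h\<close> there. From here on quotients are replaced by images.\<close>

lemma (in group) order_chirality_eq_card_image:
  assumes h: "group_hom G H h" and \<beta>: "\<beta> \<in> hom G G" and N: "N = kernel G H h"
  shows "order (G\<lparr>carrier := N <#> (\<beta> ` N)\<rparr> Mod N) = card (h ` \<beta> ` N)"
proof -
  interpret h: group_hom G H h by fact
  have sub: "\<beta> ` N \<subseteq> carrier G"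
    using \<beta> unfolding N kernel_def hom_def by auto
  have "card ((#>) N ` \<beta> ` N) = card (h ` \<beta> ` N)"
  proof (rule bij_betw_same_card)
    let ?B = "\<beta> ` N"
    \<comment> \<open>The bijection sends a coset to the common value of \<open>h\<close> on it,
      read off at a representative in \<open>?B\<close>.\<close>
    let ?\<phi> = "\<lambda>C. h (inv_into ?B ((#>) N) C)"
    have iff: "N #> x = N #> y \<longleftrightarrow> h x = h y" if "x \<in> ?B" "y \<in> ?B" for x y
      using that sub rcos_eq_iff_hom_eq[OF h, of x y] unfolding N by blast
    have phi: "?\<phi> (N #> b) = h b" if "b \<in> ?B" for b
    proof -
      let ?c = "inv_into ?B ((#>) N) (N #> b)"
      have "N #> b \<in> (#>) N ` ?B" using that by (rule imageI)
      then have "?c \<in> ?B" "N #> ?c = N #> b"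
        using inv_into_into[of _ "(#>) N"] f_inv_into_f[of _ "(#>) N"] by metis+
      then show ?thesis
        using iff that by blast
    qed
    have "inj_on ?\<phi> ((#>) N ` ?B)"
      by (intro inj_onI, elim imageE) (simp add: phi iff)
    moreover have "?\<phi> ` (#>) N ` ?B = h ` ?B"
      unfolding image_image[of ?\<phi>] by (rule image_cong[OF HOL.refl phi])
    ultimately show "bij_betw ?\<phi> ((#>) N ` ?B) (h ` ?B)"
      by (simp add: bij_betw_def)
  qed
  then show ?thesis
    using order_set_mult_Mod[OF _ sub] h.normal_kernel N by simp
qed

text \<open>The counting argument for an arbitrary endomorphism \<open>\<beta>\<close> of an
  arbitrary group. Finiteness of \<open>H\<close> makes \<open>X M\<close> positive, so that the gcd
  can be cancelled.\<close>

lemma (in group) chirality_index_dvd: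
  assumes h: "group_hom G H h" and k: "group_hom G H' k" and \<beta>: "\<beta> \<in> hom G G"
    and fin: "finite (carrier H)"
    and M: "M = kernel G H h" and K: "K = kernel G H' k"
  defines "X \<equiv> \<lambda>N. order (G\<lparr>carrier := N <#> (\<beta> ` N)\<rparr> Mod N)"
  shows "X M div gcd (X M) (order H') dvd X (M \<inter> K)"
proof -
  interpret h: group_hom G H h by fact
  interpret k: group_hom G H' k by fact
  interpret b: group_hom G G \<beta>
    by (simp add: group_hom_def group_hom_axioms_def \<beta> is_group)
  define N where "N = M \<inter> K"
  \<comment> \<open>This homomorphism has kernel \<open>M \<inter> K\<close>; its image plays the
    part of the rotation group of the mix.\<close>
  define hk where "hk x = (h x, k x)" for x
  have HH': "group (H \<times>\<times> H')"
    by (simp add: DirProd_group h.H.is_group k.H.is_group)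
  then have hk: "group_hom G (H \<times>\<times> H') hk"
    by (auto simp: group_hom_def group_hom_axioms_def is_group hk_def hom_def)
  have N_ker: "N = kernel G (H \<times>\<times> H') hk"
    by (auto simp: N_def M K kernel_def hk_def)
  have sgM: "subgroup M G" and sgN: "subgroup N G"
    unfolding M N_ker using h.subgroup_kernel group_hom.subgroup_kernel[OF hk] by auto
  have XM: "X M = card (h ` \<beta> ` M)"
    unfolding X_def by (rule order_chirality_eq_card_image[OF h \<beta> M])
  have XN: "X N = card (hk ` \<beta> ` N)"
    unfolding X_def by (rule order_chirality_eq_card_image[OF hk \<beta> N_ker])
  have sub: "M \<subseteq> carrier G" "N \<subseteq> carrier G"
    using sgM sgN by (auto simp: subgroup_def)
  have hb: "h \<circ> \<beta> \<in> hom G H" and hkb: "hk \<circ> \<beta> \<in> hom G (H \<times>\<times> H')"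
    using \<beta> h.homh group_hom.homh[OF hk] by (auto simp: hom_def Pi_iff)
  let ?M = "G\<lparr>carrier := M\<rparr>" and ?N = "G\<lparr>carrier := N\<rparr>"
  have grp: "group ?M" "group ?N"
    using sgM sgN by (auto intro: subgroup_imp_group)
  \<comment> \<open>Forgetting the \<open>k\<close> component can only enlarge the kernel.\<close>
  have "card ((h \<circ> \<beta>) ` carrier ?N) dvd card ((hk \<circ> \<beta>) ` carrier ?N)"
  proof (rule card_image_dvd_of_kernel_subset)
    show "group_hom ?N H (h \<circ> \<beta>)" "group_hom ?N (H \<times>\<times> H') (hk \<circ> \<beta>)"
      using grp HH' hom_restrict_carrier[OF hb sub(2)] hom_restrict_carrier[OF hkb sub(2)]
      by (auto simp: group_hom_def group_hom_axioms_def h.H.is_group)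
  qed (auto simp: kernel_def hk_def)
  then have 1: "card (h ` \<beta> ` N) dvd X N"
    by (simp add: XN image_comp)
  \<comment> \<open>Here \<open>\<beta>\<close> enters the first component only. The second
    component detects membership in \<open>K\<close>, so the elements of \<open>M\<close> on which
    it is trivial are exactly those of \<open>N\<close>.\<close>
  define p where "p x = (h (\<beta> x), k x)" for x
  have p: "p \<in> hom G (H \<times>\<times> H')"
    by (auto simp: p_def hom_def)
  let ?I = "(H \<times>\<times> H')\<lparr>carrier := p ` M\<rparr>"
  interpret pM: group_hom ?M "H \<times>\<times> H'" p
    using grp HH' hom_restrict_carrier[OF p sub(1)] by (simp add: group_hom_def group_hom_axioms_def)
  have "group ?I"
    using group.subgroup_imp_group[OF HH' pM.img_is_subgroup] by simp
  then interpret I: group_hom ?I H' snd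
    by (auto simp: group_hom_def group_hom_axioms_def k.H.is_group hom_def p_def mult_DirProd'
        dest!: subsetD[OF sub(1)])
  have "kernel ?I H' snd = (\<lambda>y. (y, \<one>\<^bsub>H'\<^esub>)) ` h ` \<beta> ` N"
    using sub(1) by (force simp: kernel_def p_def N_def K)
  then have "card (kernel ?I H' snd) = card (h ` \<beta> ` N)"
    by (simp add: card_image inj_on_def)
  moreover have "snd ` p ` M = k ` M"
    by (simp add: image_image p_def)
  ultimately have "card (p ` M) = card (k ` M) * card (h ` \<beta> ` N)"
    using I.order_eq_card_image_kernel by (simp add: order_def)
  moreover have "card ((h \<circ> \<beta>) ` carrier ?M) dvd card (p ` carrier ?M)"
  proof (rule card_image_dvd_of_kernel_subset)
    show "group_hom ?M H (h \<circ> \<beta>)" "group_hom ?M (H \<times>\<times> H') p"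
      using grp HH' hom_restrict_carrier[OF hb sub(1)] hom_restrict_carrier[OF p sub(1)]
      by (auto simp: group_hom_def group_hom_axioms_def h.H.is_group)
  qed (auto simp: kernel_def p_def)
  ultimately have "X M dvd card (k ` M) * card (h ` \<beta> ` N)"
    by (simp add: XM image_comp)
  also have "\<dots> dvd order H' * X N"
    using k.card_image_subgroup_dvd_order[OF sgM] 1 by (rule mult_dvd_mono)
  finally have "X M dvd order H' * X N" .
  moreover have "X M > 0"
  proof -
    have "h ` \<beta> ` M \<subseteq> carrier H" using sub by auto
    then have "finite (h ` \<beta> ` M)" using fin finite_subset by blast
    moreover have "M \<noteq> {}" using sgM subgroup.one_closed by blast
    ultimately show ?thesis unfolding XM by (simp add: card_gt_0_iff)
  qed
  ultimately show ?thesis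
    unfolding N_def by (rule dvd_div_gcd_of_dvd_mult)
qed


section \<open>Presented groups and their marked quotients\<close>

lemma word_cong_in_lists:
  "(u, v) \<in> word_cong S R \<Longrightarrow> u \<in> lists (S \<times> UNIV) \<and> v \<in> lists (S \<times> UNIV)"
  by (induction rule: word_cong.induct) auto

lemma equiv_word_cong: "equiv (lists (S \<times> UNIV)) (word_cong S R)"
proof (rule equivI)
  show "word_cong S R \<subseteq> lists (S \<times> UNIV) \<times> lists (S \<times> UNIV)"
    using word_cong_in_lists by fastforce
qed (auto simp: refl_on_def sym_def trans_def
      intro: word_cong.refl word_cong.sym dest: word_cong.trans)

text \<open>The rules \<open>cancel\<close> and \<open>relator\<close> already allow arbitrary
  contexts, so it suffices to enlarge these contexts by \<open>a\<close> and
  \<open>b\<close>.\<close>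

lemma word_cong_append:
  assumes "(u, v) \<in> word_cong S R" "a \<in> lists (S \<times> UNIV)" "b \<in> lists (S \<times> UNIV)"
  shows "(a @ u @ b, a @ v @ b) \<in> word_cong S R"
  using assms(1)
proof induction
  case (cancel u v i c)
  then show ?case
    using word_cong.cancel[of "a @ u" S "v @ b" i c R] assms(2,3) by simp
next
  case (relator u v w)
  then show ?case
    using word_cong.relator[of "a @ u" S "v @ b" w R] assms(2,3) by simp
next
  case (refl w)
  then show ?case
    using assms(2,3) by (intro word_cong.refl) simp
qed (auto intro: word_cong.sym word_cong.trans)

lemma word_cong_append2:
  assumes "(u, u') \<in> word_cong S R" "(v, v') \<in> word_cong S R"
  shows "(u @ v, u' @ v') \<in> word_cong S R"
  using word_cong_append[OF assms(1), of "[]" v] word_cong_append[OF assms(2), of u' "[]"]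
    word_cong_in_lists[OF assms(1)] word_cong_in_lists[OF assms(2)]
  by (auto intro: word_cong.trans)

text \<open>Reversing a word and flipping all signs gives its formal inverse; the product collapses
  from the middle outwards.\<close>

lemma word_cong_inverse:
  "w \<in> lists (S \<times> UNIV) \<Longrightarrow>
    (rev (map (\<lambda>(i, b). (i, \<not> b)) w) @ w, []) \<in> word_cong S R"
proof (induction w)
  case (Cons x w)
  obtain i b where x: "x = (i, b)" by force
  let ?v = "rev (map (\<lambda>(i, b). (i, \<not> b)) w)"
  have "?v \<in> lists (S \<times> UNIV)"
    using Cons.prems by (auto simp: in_lists_conv_set)
  \<comment> \<open>The double negation matches the shape of \<open>cancel\<close>, where a sign is
    followed by its negation.\<close>
  then have "(?v @ [(i, \<not> b), (i, \<not> \<not> b)] @ w, ?v @ w) \<in> word_cong S R"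
    using Cons.prems x by (intro word_cong.cancel) auto
  then show ?case
    using Cons by (auto simp: x intro: word_cong.trans)
qed (auto intro: word_cong.refl)

lemma word_class_eq_iff:
  assumes "u \<in> lists (S \<times> UNIV)" "v \<in> lists (S \<times> UNIV)"
  shows "word_cong S R `` {u} = word_cong S R `` {v} \<longleftrightarrow> (u, v) \<in> word_cong S R"
  using eq_equiv_class_iff[OF equiv_word_cong assms] .

lemma carrier_presented_groupE:
  assumes "x \<in> carrier (presented_group S R)"
  obtains w where "w \<in> lists (S \<times> UNIV)" "x = word_cong S R `` {w}"
  using assms by (auto simp: presented_group_def quotient_def)

lemma word_class_in_carrier:
  "w \<in> lists (S \<times> UNIV) \<Longrightarrow> word_cong S R `` {w} \<in> carrier (presented_group S R)"
  by (simp add: presented_group_def quotientI)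

text \<open>The product in \<open>presented_group\<close> is the saturation of a set of
  concatenations; by compatibility with concatenation it is a single class, so one may compute with
  representatives.\<close>

lemma mult_presented_group:
  assumes "u \<in> lists (S \<times> UNIV)" "v \<in> lists (S \<times> UNIV)"
  shows "word_cong S R `` {u} \<otimes>\<^bsub>presented_group S R\<^esub> word_cong S R `` {v}
    = word_cong S R `` {u @ v}"
proof -
  have "word_cong S R `` {a @ b | a b. a \<in> word_cong S R `` {u} \<and> b \<in> word_cong S R `` {v}}
      = word_cong S R `` {u @ v}"
  proof (intro equalityI subsetI)
    fix x assume "x \<in> word_cong S R `` {u @ v}"
    then show "x \<in> word_cong S R `` {a @ b | a b. a \<in> word_cong S R `` {u} \<and> b \<in> word_cong S R `` {v}}"
      using word_cong.refl[OF assms(1)] word_cong.refl[OF assms(2)] by blast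
  qed (auto intro: word_cong_append2 word_cong.trans)
  then show ?thesis
    by (simp add: presented_group_def)
qed

lemma one_presented_group: "\<one>\<^bsub>presented_group S R\<^esub> = word_cong S R `` {[]}"
  by (simp add: presented_group_def)

lemma group_presented_group: "group (presented_group S R)"
proof (rule groupI)
  let ?G = "presented_group S R"
  show "\<one>\<^bsub>?G\<^esub> \<in> carrier ?G"
    by (simp add: one_presented_group word_class_in_carrier)
  fix x assume "x \<in> carrier ?G"
  then obtain u where u: "u \<in> lists (S \<times> UNIV)" "x = word_cong S R `` {u}"
    by (rule carrier_presented_groupE)
  then show "\<one>\<^bsub>?G\<^esub> \<otimes>\<^bsub>?G\<^esub> x = x"
    by (simp add: one_presented_group mult_presented_group)
  let ?v = "rev (map (\<lambda>(i, b). (i, \<not> b)) u)"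
  have v: "?v \<in> lists (S \<times> UNIV)"
    using u by (auto simp: in_lists_conv_set)
  have "word_cong S R `` {?v} \<otimes>\<^bsub>?G\<^esub> x = \<one>\<^bsub>?G\<^esub>"
    using u v word_cong_inverse[OF u(1)]
    by (simp add: one_presented_group mult_presented_group word_class_eq_iff)
  then show "\<exists>y\<in>carrier ?G. y \<otimes>\<^bsub>?G\<^esub> x = \<one>\<^bsub>?G\<^esub>"
    using word_class_in_carrier[OF v] by blast
  fix y assume "y \<in> carrier ?G"
  then obtain v where v: "v \<in> lists (S \<times> UNIV)" "y = word_cong S R `` {v}"
    by (rule carrier_presented_groupE)
  then show "x \<otimes>\<^bsub>?G\<^esub> y \<in> carrier ?G"
    using u by (simp add: mult_presented_group word_class_in_carrier)
  fix z assume "z \<in> carrier ?G"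
  then obtain w where "w \<in> lists (S \<times> UNIV)" "z = word_cong S R `` {w}"
    by (rule carrier_presented_groupE)
  then show "x \<otimes>\<^bsub>?G\<^esub> y \<otimes>\<^bsub>?G\<^esub> z = x \<otimes>\<^bsub>?G\<^esub> (y \<otimes>\<^bsub>?G\<^esub> z)"
    using u v by (simp add: mult_presented_group)
qed

section \<open>Evaluation of words and the universal property\<close>

lemma word_eval_Nil [simp]: "word_eval G s [] = \<one>\<^bsub>G\<^esub>"
  by (simp add: word_eval_def)

lemma word_eval_Cons [simp]:
  "word_eval G s ((i, b) # w) = (if b then s i else inv\<^bsub>G\<^esub> s i) \<otimes>\<^bsub>G\<^esub> word_eval G s w"
  by (simp add: word_eval_def)

context group
begin

lemma word_eval_closed:
  assumes "s \<in> S \<rightarrow> carrier G" "w \<in> lists (S \<times> UNIV)"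
  shows "word_eval G s w \<in> carrier G"
  using assms(2)
proof (induction w)
  case (Cons x w)
  obtain i b where "x = (i, b)" by force
  then show ?case
    using Cons assms(1) by auto
qed simp

lemma word_eval_append:
  assumes "s \<in> S \<rightarrow> carrier G" "u \<in> lists (S \<times> UNIV)" "v \<in> lists (S \<times> UNIV)"
  shows "word_eval G s (u @ v) = word_eval G s u \<otimes> word_eval G s v"
  using assms(2)
proof (induction u)
  case Nil
  then show ?case using word_eval_closed[OF assms(1,3)] by simp
next
  case (Cons x u)
  obtain i b where "x = (i, b)" by force
  then show ?case
    using Cons word_eval_closed[OF assms(1) Cons.hyps(2)] word_eval_closed[OF assms(1,3)] assms(1)
    by (auto simp: m_assoc Pi_iff)
qed

lemma word_eval_subgroup:
  assumes "subgroup H G" "s \<in> S \<rightarrow> H" "w \<in> lists (S \<times> UNIV)"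
  shows "word_eval (G\<lparr>carrier := H\<rparr>) s w = word_eval G s w"
  using assms(3)
proof (induction w)
  case (Cons x w)
  obtain i b where "x = (i, b)" by force
  then show ?case
    using Cons assms(1,2) by (auto simp: Pi_iff)
qed simp

text \<open>Each generating step of the congruence leaves the value unchanged. This makes
  \<open>induced_hom\<close> well defined.\<close>

lemma word_eval_word_cong:
  assumes s: "s \<in> S \<rightarrow> carrier G"
    and R: "\<And>w. w \<in> R \<Longrightarrow> w \<in> lists (S \<times> UNIV) \<Longrightarrow> word_eval G s w = \<one>"
    and "(u, v) \<in> word_cong S R"
  shows "word_eval G s u = word_eval G s v"
  using assms(3)
proof induction
  case (cancel u v i b)
  then show ?case
    using word_eval_closed[OF s] s
    by (cases b) (auto simp: word_eval_append[OF s] Pi_iff simp flip: m_assoc)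
next
  case (relator u v w)
  then show ?case
    using word_eval_closed[OF s] by (simp add: word_eval_append[OF s] R)
qed auto

text \<open>All words of a class have the same value, so \<open>the_elem\<close> in
  \<open>induced_hom\<close> is applied to a singleton.\<close>

lemma induced_hom_word_class:
  assumes "s \<in> S \<rightarrow> carrier G"
    and "\<And>w. w \<in> R \<Longrightarrow> w \<in> lists (S \<times> UNIV) \<Longrightarrow> word_eval G s w = \<one>"
    and "w \<in> lists (S \<times> UNIV)"
  shows "induced_hom G s (word_cong S R `` {w}) = word_eval G s w"
proof -
  have "word_eval G s ` (word_cong S R `` {w}) = {word_eval G s w}"
    using word_eval_word_cong[OF assms(1,2)] word_cong.refl[OF assms(3)]
    by (auto simp: image_iff)
  then show ?thesis
    by (simp add: induced_hom_def)
qed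

text \<open>Von Dyck's theorem.\<close>

lemma group_hom_induced_hom:
  assumes "s \<in> S \<rightarrow> carrier G"
    and "\<And>w. w \<in> R \<Longrightarrow> w \<in> lists (S \<times> UNIV) \<Longrightarrow> word_eval G s w = \<one>"
  shows "group_hom (presented_group S R) G (induced_hom G s)"
proof -
  have "induced_hom G s \<in> hom (presented_group S R) G"
    by (rule homI; elim carrier_presented_groupE)
      (auto simp: induced_hom_word_class[OF assms] mult_presented_group
        word_eval_append[OF assms(1)] word_eval_closed[OF assms(1)])
  then show ?thesis
    by (simp add: group_hom_def group_hom_axioms_def group_presented_group is_group)
qed

end

text \<open>Evaluation at the generators themselves is the projection to classes; hence the
  generators of \<open>Wplus\<close> satisfy its relations.\<close>

lemma word_eval_presented_group:
  assumes "w \<in> lists (S \<times> UNIV)"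
  shows "word_eval (presented_group S R) (\<lambda>i. word_cong S R `` {[(i, True)]}) w
    = word_cong S R `` {w}"
  using assms
proof (induction w)
  case Nil
  then show ?case by (simp add: one_presented_group)
next
  case (Cons x w)
  interpret group "presented_group S R" by (rule group_presented_group)
  obtain i b where x: "x = (i, b)" by force
  then have i: "i \<in> S" using Cons.hyps by simp
  have "inv\<^bsub>presented_group S R\<^esub> (word_cong S R `` {[(i, True)]}) = word_cong S R `` {[(i, False)]}"
  proof (rule inv_equality)
    have "([(i, False), (i, True)], []) \<in> word_cong S R"
      using word_cong_inverse[of "[(i, True)]" S R] i by simp
    then show "word_cong S R `` {[(i, False)]} \<otimes>\<^bsub>presented_group S R\<^esub> word_cong S R `` {[(i, True)]}
        = \<one>\<^bsub>presented_group S R\<^esub>"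
      using i by (simp add: mult_presented_group one_presented_group word_class_eq_iff)
  qed (use i in \<open>auto intro: word_class_in_carrier\<close>)
  then show ?case
    using Cons i by (simp add: x mult_presented_group)
qed

section \<open>The relations of \<open>W\<^sup>+\<close> and the bar map\<close>

text \<open>The word \<open>\<sigma>\<^sub>i \<dots> \<sigma>\<^sub>j\<close>, that is, half of a
  relator of \<open>W\<^sup>+\<close>. It is empty for \<open>j < i\<close>.\<close>

definition rotation_word :: "nat \<Rightarrow> nat \<Rightarrow> nat word" where
  "rotation_word i j = map (\<lambda>k. (k, True)) [i..<Suc j]"

text \<open>The relators are split into squares, because the geometric argument determines the half
  word first and then squares it.\<close>

definition satisfies_Wplus_relations :: "nat \<Rightarrow> ('g, 'm) monoid_scheme \<Rightarrow> (nat \<Rightarrow> 'g) \<Rightarrow> bool" where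
  "satisfies_Wplus_relations n G s \<longleftrightarrow> s \<in> {1..<n} \<rightarrow> carrier G \<and>
    (\<forall>i j. 1 \<le> i \<and> i < j \<and> j < n \<longrightarrow>
      word_eval G s (rotation_word i j) \<otimes>\<^bsub>G\<^esub> word_eval G s (rotation_word i j) = \<one>\<^bsub>G\<^esub>)"

lemma rotation_word_in_lists:
  "1 \<le> i \<Longrightarrow> j < n \<Longrightarrow> rotation_word i j \<in> lists ({1..<n} \<times> UNIV)"
  by (auto simp: rotation_word_def)

lemma rotation_word_Cons: "i \<le> j \<Longrightarrow> rotation_word i j = (i, True) # rotation_word (Suc i) j"
  by (simp add: rotation_word_def upt_rec del: upt_Suc)

lemma word_eval_cong_rotation_word:
  "(\<And>k. i \<le> k \<Longrightarrow> k \<le> j \<Longrightarrow> s k = t k) \<Longrightarrow>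
    word_eval G s (rotation_word i j) = word_eval G t (rotation_word i j)"
  by (auto simp: word_eval_def rotation_word_def foldr_map intro!: foldr_cong)

lemma (in group) word_eval_Wplus_relator:
  assumes "satisfies_Wplus_relations n G s" "w \<in> Wplus_relators n"
  shows "word_eval G s w = \<one>"
proof -
  obtain i j where w: "w = rotation_word i j @ rotation_word i j" and "1 \<le> i" "i < j" "j < n"
    using assms(2) by (auto simp: Wplus_relators_def rotation_word_def)
  with assms(1) show ?thesis
    by (auto simp: satisfies_Wplus_relations_def word_eval_append[OF _ rotation_word_in_lists rotation_word_in_lists])
qed

lemma (in group)
  assumes "satisfies_Wplus_relations n G s"
  shows group_hom_Wplus: "group_hom (Wplus n) G (induced_hom G s)"
    and induced_hom_Wplus_word_class: "w \<in> lists ({1..<n} \<times> UNIV) \<Longrightarrow>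
      induced_hom G s (word_cong {1..<n} (Wplus_relators n) `` {w}) = word_eval G s w"
proof -
  have s: "s \<in> {1..<n} \<rightarrow> carrier G"
    using assms by (simp add: satisfies_Wplus_relations_def)
  show "group_hom (Wplus n) G (induced_hom G s)"
    unfolding Wplus_def
    by (rule group_hom_induced_hom[OF s word_eval_Wplus_relator[OF assms]])
  show "induced_hom G s (word_cong {1..<n} (Wplus_relators n) `` {w}) = word_eval G s w"
    if "w \<in> lists ({1..<n} \<times> UNIV)"
    by (rule induced_hom_word_class[OF s word_eval_Wplus_relator[OF assms] that])
qed

lemma group_Wplus: "group (Wplus n)"
  by (simp add: Wplus_def group_presented_group)

lemma satisfies_Wplus_gen: "satisfies_Wplus_relations n (Wplus n) (Wplus_gen n)"
proof -
  let ?S = "{1..<n}" and ?R = "Wplus_relators n"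
  have ev: "word_eval (Wplus n) (Wplus_gen n) w = word_cong ?S ?R `` {w}"
    if "w \<in> lists (?S \<times> UNIV)" for w
    using word_eval_presented_group[OF that, of ?R] by (simp add: Wplus_def Wplus_gen_def[abs_def])
  have "word_cong ?S ?R `` {rotation_word i j} \<otimes>\<^bsub>Wplus n\<^esub> word_cong ?S ?R `` {rotation_word i j}
      = \<one>\<^bsub>Wplus n\<^esub>" if "1 \<le> i" "i < j" "j < n" for i j
  proof -
    have w: "rotation_word i j \<in> lists (?S \<times> UNIV)"
      using that by (intro rotation_word_in_lists) auto
    have "rotation_word i j @ rotation_word i j \<in> ?R"
      using that unfolding Wplus_relators_def rotation_word_def by blast
    then have "(rotation_word i j @ rotation_word i j, []) \<in> word_cong ?S ?R"
      using word_cong.relator[of "[]" ?S "[]" "rotation_word i j @ rotation_word i j" ?R] w by simp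
    then show ?thesis
      using w by (simp add: Wplus_def mult_presented_group one_presented_group word_class_eq_iff)
  qed
  moreover have "Wplus_gen n \<in> ?S \<rightarrow> carrier (Wplus n)"
    by (auto simp: Wplus_gen_def Wplus_def intro!: word_class_in_carrier)
  ultimately show ?thesis
    unfolding satisfies_Wplus_relations_def using ev rotation_word_in_lists by simp
qed

text \<open>This makes the bar map well defined. The new generators give the same products from 1 to
  \<open>j\<close>, and from \<open>i\<close> to \<open>j\<close> when \<open>i \<ge> 3\<close>.
  Only \<open>i = 2\<close> changes: there the product is \<open>\<sigma>\<^sub>1\<close> times
  \<open>\<sigma>\<^sub>1 \<dots> \<sigma>\<^sub>j\<close>.\<close>

lemma (in group) satisfies_Wplus_relations_bar:
  assumes "satisfies_Wplus_relations n G s"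
  shows "satisfies_Wplus_relations n G
    (\<lambda>i. if i = 1 then inv s 1 else if i = 2 then s 1 [^] (2::nat) \<otimes> s 2 else s i)"
    (is "satisfies_Wplus_relations n G ?t")
  unfolding satisfies_Wplus_relations_def
proof (intro conjI allI impI)
  have s: "s k \<in> carrier G" if "k \<in> {1..<n}" for k
    using assms that by (auto simp: satisfies_Wplus_relations_def)
  then show "?t \<in> {1..<n} \<rightarrow> carrier G"
    by auto
  fix i j assume ij: "1 \<le> i \<and> i < j \<and> j < n"
  let ?e = "\<lambda>i. word_eval G s (rotation_word i j)"
  let ?f = "\<lambda>i. word_eval G ?t (rotation_word i j)"
  have e: "?e k \<in> carrier G" if "1 \<le> k" for k
    using that ij assms
    by (intro word_eval_closed[where S = "{1..<n}"] rotation_word_in_lists)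
      (auto simp: satisfies_Wplus_relations_def)
  have rel: "?e k \<otimes> ?e k = \<one>" if "1 \<le> k" "k < j" for k
    using that ij assms by (simp add: satisfies_Wplus_relations_def)
  have f3: "?f k = ?e k" if "3 \<le> k" for k
    using that by (intro word_eval_cong_rotation_word) simp
  have s1: "s 1 \<in> carrier G" and s2: "s 2 \<in> carrier G"
    using s ij by auto
  \<comment> \<open>For \<open>j = 2\<close> the word starting at 3 is empty and \<open>?e 3\<close>
    is \<open>\<one>\<close>, so this case needs no separate treatment.\<close>
  have e1: "?e 1 = s 1 \<otimes> ?e 2" and e2: "?e 2 = s 2 \<otimes> ?e 3"
    using ij by (simp_all add: rotation_word_Cons numeral_2_eq_2 numeral_3_eq_3)
  have f2: "?f 2 = s 1 \<otimes> ?e 1"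
  proof -
    have "?f 2 = (s 1 [^] (2::nat) \<otimes> s 2) \<otimes> ?f 3"
      using ij by (simp add: rotation_word_Cons[of 2] numeral_3_eq_3)
    also have "\<dots> = (s 1 \<otimes> s 1 \<otimes> s 2) \<otimes> ?e 3"
      using s1 by (subst f3) (simp_all add: numeral_2_eq_2)
    also have "\<dots> = s 1 \<otimes> ?e 1"
      using s1 s2 e[of 3] unfolding e1 e2 by (simp add: m_assoc)
    finally show ?thesis .
  qed
  have f1: "?f 1 = ?e 1"
  proof -
    have "?f 1 = inv s 1 \<otimes> ?f 2"
      using ij by (simp add: rotation_word_Cons[of "Suc 0"] numeral_2_eq_2)
    then show ?thesis
      unfolding f2 using s1 e[of 1] by (simp flip: m_assoc)
  qed
  consider "i = 1" | "i = 2" | "3 \<le> i" using ij by linarith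
  then show "?f i \<otimes> ?f i = \<one>"
  proof cases
    case 1
    then show ?thesis using f1 rel ij by simp
  next
    case 2
    have c: "?e 1 \<in> carrier G" "?e 2 \<in> carrier G" using e by simp_all
    have r: "?e 1 \<otimes> ?e 1 = \<one>" "?e 2 \<otimes> ?e 2 = \<one>" using rel 2 ij by auto
    \<comment> \<open>\<open>s 1\<close> is a product of two involutions, so \<open>?f 2\<close> is a conjugate of an involution.\<close>
    have s1_eq: "s 1 = ?e 1 \<otimes> ?e 2"
      unfolding e1 using s1 c r by (simp add: m_assoc)
    have "?f 2 = ?e 1 \<otimes> ?e 2 \<otimes> ?e 1"
      unfolding f2 by (rule arg_cong[OF s1_eq])
    then have "?f 2 \<otimes> ?f 2 = (?e 1 \<otimes> ?e 2 \<otimes> ?e 1) \<otimes> (?e 1 \<otimes> ?e 2 \<otimes> ?e 1)"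
      by (simp only:)
    also have "\<dots> = ?e 1 \<otimes> (?e 2 \<otimes> (?e 1 \<otimes> ?e 1) \<otimes> ?e 2) \<otimes> ?e 1"
      using c by (simp only: m_assoc m_closed)
    also have "\<dots> = \<one>"
      using c r by (simp only: r_one)
    finally show ?thesis using 2 by simp
  next
    case 3
    then show ?thesis using f3 rel ij by simp
  qed
qed

lemma Wplus_bar_hom: "Wplus_bar n \<in> hom (Wplus n) (Wplus n)"
proof -
  interpret W: group "Wplus n" by (rule group_Wplus)
  show ?thesis
    unfolding Wplus_bar_def
    using W.group_hom_Wplus[OF W.satisfies_Wplus_relations_bar[OF satisfies_Wplus_gen]]
    by (rule group_hom.homh)
qed

lemma satisfies_Wplus_relations_subgroup:
  assumes "group G" "satisfies_Wplus_relations n G s" "subgroup H G" "s \<in> {1..<n} \<rightarrow> H"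
  shows "satisfies_Wplus_relations n (G\<lparr>carrier := H\<rparr>) s"
  unfolding satisfies_Wplus_relations_def
proof (intro conjI allI impI)
  fix i j assume ij: "1 \<le> i \<and> i < j \<and> j < n"
  then have "rotation_word i j \<in> lists ({1..<n} \<times> UNIV)"
    by (intro rotation_word_in_lists) auto
  then show "word_eval (G\<lparr>carrier := H\<rparr>) s (rotation_word i j) \<otimes>\<^bsub>G\<lparr>carrier := H\<rparr>\<^esub>
      word_eval (G\<lparr>carrier := H\<rparr>) s (rotation_word i j) = \<one>\<^bsub>G\<lparr>carrier := H\<rparr>\<^esub>"
    using assms(2) ij
    by (simp only: group.word_eval_subgroup[OF assms(1,3,4)])
      (simp add: satisfies_Wplus_relations_def)
qed (use assms(4) in simp)

section \<open>The mix as a quotient of \<open>W\<^sup>+\<close>\<close>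

lemma word_eval_DirProd:
  assumes "group G" "group H" "s \<in> S \<rightarrow> carrier G" "t \<in> S \<rightarrow> carrier H" "w \<in> lists (S \<times> UNIV)"
  shows "word_eval (G \<times>\<times> H) (\<lambda>i. (s i, t i)) w = (word_eval G s w, word_eval H t w)"
  using assms(5)
proof (induction w)
  case (Cons x w)
  obtain i b where "x = (i, b)" by force
  then show ?case
    using Cons assms by (auto simp: Pi_iff inv_DirProd)
qed simp

text \<open>Words evaluate coordinatewise in the mix, so a class becomes trivial there exactly when
  it does so in both factors.\<close>

lemma relation_subgroup_mix:
  assumes "group G" "group H" "satisfies_Wplus_relations n G s" "satisfies_Wplus_relations n H t"
  shows "relation_subgroup n (mix n (G, s) (H, t))
    = relation_subgroup n (G, s) \<inter> relation_subgroup n (H, t)"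
proof -
  let ?D = "G \<times>\<times> H" and ?u = "\<lambda>i. (s i, t i)"
  let ?I = "generate ?D (?u ` {1..<n})"
  let ?E = "?D\<lparr>carrier := ?I\<rparr>"
  interpret G: group G by fact
  interpret H: group H by fact
  interpret D: group ?D by (rule DirProd_group[OF assms(1,2)])
  have st: "s \<in> {1..<n} \<rightarrow> carrier G" "t \<in> {1..<n} \<rightarrow> carrier H"
    using assms(3,4) by (auto simp: satisfies_Wplus_relations_def)
  have sg: "subgroup ?I ?D"
    using st by (intro D.generate_is_subgroup) auto
  then interpret E: group ?E by (rule D.subgroup_imp_group)
  have u: "?u \<in> {1..<n} \<rightarrow> ?I"
    by (auto intro: generate.incl)
  have ev: "word_eval ?E ?u w = (word_eval G s w, word_eval H t w)"
    if "w \<in> lists ({1..<n} \<times> UNIV)" for w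
    using D.word_eval_subgroup[OF sg u that] word_eval_DirProd[OF assms(1,2) st that] by simp
  \<comment> \<open>The relations are established in the mix first, so that
    \<open>induced_hom\<close> into it can be computed by \<open>word_eval\<close>.\<close>
  have E: "satisfies_Wplus_relations n ?E ?u"
    unfolding satisfies_Wplus_relations_def
  proof (intro conjI allI impI)
    fix i j assume ij: "1 \<le> i \<and> i < j \<and> j < n"
    then have "rotation_word i j \<in> lists ({1..<n} \<times> UNIV)"
      by (intro rotation_word_in_lists) auto
    then show "word_eval ?E ?u (rotation_word i j) \<otimes>\<^bsub>?E\<^esub> word_eval ?E ?u (rotation_word i j) = \<one>\<^bsub>?E\<^esub>"
      using assms(3,4) ij by (simp only: ev) (simp add: satisfies_Wplus_relations_def)
  qed (use u in simp)
  have "induced_hom ?E ?u x = (induced_hom G s x, induced_hom H t x)"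
    if "x \<in> carrier (Wplus n)" for x
    using that unfolding Wplus_def
    by (rule carrier_presented_groupE)
      (simp only: E.induced_hom_Wplus_word_class[OF E] G.induced_hom_Wplus_word_class[OF assms(3)]
        H.induced_hom_Wplus_word_class[OF assms(4)] ev)
  then show ?thesis
    by (auto simp: relation_subgroup_def mix_def Let_def kernel_def)
qed

text \<open>The second divisibility is the first with the two groups exchanged; the mix enters only
  through an intersection, which is symmetric.\<close>

lemma order_chirality_group_mix_dvd:
  fixes G :: "'g monoid" and H :: "'h monoid"
  assumes "group G" "group H" "satisfies_Wplus_relations n G s" "satisfies_Wplus_relations n H t"
    and "finite (carrier G)" "finite (carrier H)"
  defines "X \<equiv> order (chirality_group n (G, s))" and "Y \<equiv> order (chirality_group n (H, t))"
    and "Z \<equiv> order (chirality_group n (mix n (G, s) (H, t)))"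
  shows "X div gcd X (order H) dvd Z" "Y div gcd Y (order G) dvd Z"
proof -
  interpret W: group "Wplus n" by (rule group_Wplus)
  note hG = group.group_hom_Wplus[OF assms(1,3)] and hH = group.group_hom_Wplus[OF assms(2,4)]
  note unf = X_def Y_def Z_def chirality_group_def Let_def relation_subgroup_mix[OF assms(1-4)]
  show "X div gcd X (order H) dvd Z"
    using W.chirality_index_dvd[OF hG hH Wplus_bar_hom assms(5) HOL.refl HOL.refl]
    unfolding unf by (simp add: relation_subgroup_def)
  show "Y div gcd Y (order G) dvd Z"
    using W.chirality_index_dvd[OF hH hG Wplus_bar_hom assms(6) HOL.refl HOL.refl]
    unfolding unf by (simp add: relation_subgroup_def Int_commute)
qed


section \<open>Flags and automorphisms of a finite polytope\<close>

lemma in_Chains_iff: "C \<in> Chains r \<longleftrightarrow> (\<forall>x\<in>C. \<forall>y\<in>C. (x, y) \<in> r \<or> (y, x) \<in> r)"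
  by (auto simp: Chains_def)

lemma Chains_subset_Field: "C \<in> Chains r \<Longrightarrow> C \<subseteq> Field r"
  by (auto simp: in_Chains_iff Field_def)

lemma flags_subset_Chains: "flags r \<subseteq> Chains r"
  by (auto simp: flags_def)

lemma flagI:
  "C \<in> Chains r \<Longrightarrow> (\<And>D. D \<in> Chains r \<Longrightarrow> C \<subseteq> D \<Longrightarrow> D = C) \<Longrightarrow> C \<in> flags r"
  by (auto simp: flags_def)

lemma flag_maximal: "F \<in> flags r \<Longrightarrow> D \<in> Chains r \<Longrightarrow> F \<subseteq> D \<Longrightarrow> D = F"
  by (auto simp: flags_def)

lemma flag_subset_Field: "F \<in> flags r \<Longrightarrow> F \<subseteq> Field r"
  using flags_subset_Chains Chains_subset_Field by blast

lemma flag_total: "F \<in> flags r \<Longrightarrow> x \<in> F \<Longrightarrow> y \<in> F \<Longrightarrow> (x, y) \<in> r \<or> (y, x) \<in> r"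
  by (auto simp: flags_def in_Chains_iff)

text \<open>For distinct flags of a polytope this is \<open>i\<close>-adjacency, by
  \<open>adjacent_at_rank_iff\<close>. It composes more easily than the cardinalities in
  \<open>adjacent\<close>. The rank is an integer because ranks start at \<open>-1\<close>.\<close>

definition agree_off :: "'a rel \<Rightarrow> int \<Rightarrow> 'a set \<Rightarrow> 'a set \<Rightarrow> bool" where
  "agree_off r i F G \<longleftrightarrow> (\<forall>x. face_rank r x \<noteq> i \<longrightarrow> (x \<in> F \<longleftrightarrow> x \<in> G))"

lemma agree_off_sym: "agree_off r i F G \<Longrightarrow> agree_off r i G F"
  by (auto simp: agree_off_def)

locale finite_polytope =
  fixes n :: nat and r :: "'a rel"
  assumes polytope: "abstract_polytope n r" and finite_Field: "finite (Field r)"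
begin

lemma r_refl: "x \<in> Field r \<Longrightarrow> (x, x) \<in> r"
  using polytope by (auto simp: abstract_polytope_def partial_order_on_def preorder_on_def refl_on_def)

lemma r_trans: "(x, y) \<in> r \<Longrightarrow> (y, z) \<in> r \<Longrightarrow> (x, z) \<in> r"
  using polytope by (auto simp: abstract_polytope_def partial_order_on_def preorder_on_def dest: transD)

lemma r_antisym: "(x, y) \<in> r \<Longrightarrow> (y, x) \<in> r \<Longrightarrow> x = y"
  using polytope by (auto simp: abstract_polytope_def partial_order_on_def dest: antisymD)

lemma card_flag: "F \<in> flags r \<Longrightarrow> card F = n + 2"
  using polytope by (simp add: abstract_polytope_def)

lemma finite_flag: "F \<in> flags r \<Longrightarrow> finite F"
  using flag_subset_Field finite_Field finite_subset by blast

lemma chain_in_flag: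
  assumes "C \<in> Chains r"
  obtains F where "F \<in> flags r" "C \<subseteq> F"
proof -
  have "Chains r \<subseteq> Pow (Field r)"
    using Chains_subset_Field by blast
  then have "finite (Chains r)"
    using finite_Field finite_subset by blast
  from finite_has_maximal2[OF this assms] show thesis
    using that by (auto simp: flags_def)
qed

text \<open>A flag containing \<open>C\<close> has the same finite size and so equals
  \<open>C\<close>. This is how new flags are recognised later.\<close>

lemma chain_card_flag:
  assumes "C \<in> Chains r" "card C = n + 2"
  shows "C \<in> flags r"
proof -
  obtain F where "F \<in> flags r" "C \<subseteq> F"
    using assms(1) by (rule chain_in_flag)
  then show ?thesis
    using assms(2) card_flag card_subset_eq finite_flag by metis
qed

lemma face_in_flag:
  assumes "x \<in> Field r"
  obtains F where "F \<in> flags r" "x \<in> F"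
proof -
  have "{x} \<in> Chains r"
    using assms by (simp add: in_Chains_iff r_refl)
  then show thesis
    using that by (auto elim: chain_in_flag)
qed

lemma face_pair_in_flag:
  assumes "(x, y) \<in> r"
  obtains F where "F \<in> flags r" "x \<in> F" "y \<in> F"
proof -
  have "x \<in> Field r" "y \<in> Field r"
    using assms by (auto simp: Field_def)
  then have "{x, y} \<in> Chains r"
    using assms by (auto simp: in_Chains_iff r_refl)
  then show thesis
    using that by (auto elim: chain_in_flag)
qed

section \<open>The rank function\<close>

text \<open>A chain below \<open>x\<close> that extends the lower part of \<open>F\<close> forms a
  chain together with all of \<open>F\<close>, so maximality of \<open>F\<close> applies.\<close>

lemma flag_below_face:
  assumes F: "F \<in> flags r" and x: "x \<in> F"
  shows "{z \<in> F. (z, x) \<in> r} \<in> flags (Restr r {z. (z, x) \<in> r})"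
proof -
  have "D = {z \<in> F. (z, x) \<in> r}"
    if D: "D \<in> Chains (Restr r {z. (z, x) \<in> r})" and sub: "{z \<in> F. (z, x) \<in> r} \<subseteq> D" for D
  proof -
    have Dx: "(d, x) \<in> r" if "d \<in> D" for d
      using D that by (auto simp: in_Chains_iff)
    have "F \<union> D \<in> Chains r"
      unfolding in_Chains_iff
    proof (intro ballI)
      have mixed: "(u, v) \<in> r \<or> (v, u) \<in> r" if "u \<in> F" "v \<in> D" for u v
      proof (cases "(u, x) \<in> r")
        case True
        then have "u \<in> D" using sub that by blast
        then show ?thesis using D that by (auto simp: in_Chains_iff)
      next
        case False
        then have "(x, u) \<in> r" using flag_total[OF F that(1) x] by blast
        then show ?thesis using Dx[OF that(2)] r_trans by blast
      qed
      fix u v assume "u \<in> F \<union> D" "v \<in> F \<union> D"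
      then show "(u, v) \<in> r \<or> (v, u) \<in> r"
        using mixed[of u v] mixed[of v u] flag_total[OF F, of u v] D by (auto simp: in_Chains_iff)
    qed
    then have "F \<union> D = F" using F by (intro flag_maximal) auto
    then show ?thesis using Dx sub by blast
  qed
  moreover have "{z \<in> F. (z, x) \<in> r} \<in> Chains (Restr r {z. (z, x) \<in> r})"
    using flag_total[OF F] by (auto simp: in_Chains_iff)
  ultimately show ?thesis
    by (simp add: flags_def)
qed

text \<open>Surgery at \<open>x\<close>: the lower part of a flag can be exchanged for any flag
  below \<open>x\<close>. It serves to compare the sizes of such flags.\<close>

lemma replace_flag_below_face:
  assumes F: "F \<in> flags r" and x: "x \<in> F" and C: "C \<in> flags (Restr r {z. (z, x) \<in> r})"
  shows "C \<union> {z \<in> F. (x, z) \<in> r} \<in> flags r"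
proof -
  let ?U = "{z \<in> F. (x, z) \<in> r}"
  have xx: "(x, x) \<in> r"
    using flag_subset_Field[OF F] x r_refl by blast
  have C_chain: "(u, v) \<in> r \<or> (v, u) \<in> r" if "u \<in> C" "v \<in> C" for u v
    using flag_total[OF C that] by blast
  have Cx: "(u, x) \<in> r" if "u \<in> C" for u
    using flag_total[OF C that that] by blast
  have "C \<union> ?U \<in> Chains r"
    unfolding in_Chains_iff
    using C_chain Cx flag_total[OF F] r_trans by (metis (no_types, lifting) Un_iff mem_Collect_eq)
  moreover have "D = C \<union> ?U" if D: "D \<in> Chains r" and sub: "C \<union> ?U \<subseteq> D" for D
  proof -
    have xD: "x \<in> D"
      using sub x xx by blast
    have Dtot: "(u, v) \<in> r \<or> (v, u) \<in> r" if "u \<in> D" "v \<in> D" for u v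
      using D that by (simp add: in_Chains_iff)
    \<comment> \<open>The chain \<open>D\<close> is cut at \<open>x\<close>: maximality of
      \<open>C\<close> controls its lower part and maximality of \<open>F\<close> its upper
      part.\<close>
    have below: "{z \<in> D. (z, x) \<in> r} = C"
    proof (rule flag_maximal[OF C])
      show "{z \<in> D. (z, x) \<in> r} \<in> Chains (Restr r {z. (z, x) \<in> r})"
        using Dtot by (auto simp: in_Chains_iff)
    qed (use sub Cx in blast)
    have "F \<union> {z \<in> D. (x, z) \<in> r} = F"
    proof (rule flag_maximal[OF F])
      have mixed: "(u, v) \<in> r \<or> (v, u) \<in> r" if "u \<in> F" "v \<in> D" "(x, v) \<in> r" for u v
      proof (cases "(u, x) \<in> r")
        case True
        then show ?thesis using that(3) r_trans by blast
      next
        case False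
        then have "(x, u) \<in> r" using flag_total[OF F that(1) x] by blast
        then have "u \<in> D" using that(1) sub by blast
        then show ?thesis using Dtot that(2) by blast
      qed
      show "F \<union> {z \<in> D. (x, z) \<in> r} \<in> Chains r"
        unfolding in_Chains_iff
      proof (intro ballI)
        fix u v assume "u \<in> F \<union> {z \<in> D. (x, z) \<in> r}" "v \<in> F \<union> {z \<in> D. (x, z) \<in> r}"
        then show "(u, v) \<in> r \<or> (v, u) \<in> r"
          using mixed[of u v] mixed[of v u] flag_total[OF F, of u v] Dtot[of u v] by blast
      qed
    qed blast
    then show ?thesis
      using below sub Dtot[OF _ xD] by blast
  qed
  ultimately show ?thesis
    by (rule flagI)
qed

text \<open>After the surgery the flag still has \<open>n + 2\<close> faces and the same upper part,
  so the old and the new lower part have equal size.\<close>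

lemma card_flag_below_face:
  assumes F: "F \<in> flags r" and x: "x \<in> F" and C: "C \<in> flags (Restr r {z. (z, x) \<in> r})"
  shows "card C = card {z \<in> F. (z, x) \<in> r}"
proof -
  let ?U = "{z \<in> F. (x, z) \<in> r \<and> z \<noteq> x}"
  have xx: "(x, x) \<in> r"
    using flag_subset_Field[OF F] x r_refl by blast
  \<comment> \<open>The face \<open>x\<close> is counted in the lower part only.\<close>
  have split: "card {z \<in> G. (z, x) \<in> r} + card {z \<in> G. (x, z) \<in> r \<and> z \<noteq> x} = n + 2"
    if G: "G \<in> flags r" "x \<in> G" for G
  proof -
    have "{z \<in> G. (z, x) \<in> r} \<union> {z \<in> G. (x, z) \<in> r \<and> z \<noteq> x} = G"
      using flag_total[OF G(1) _ G(2)] xx by auto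
    moreover have "{z \<in> G. (z, x) \<in> r} \<inter> {z \<in> G. (x, z) \<in> r \<and> z \<noteq> x} = {}"
      using r_antisym by blast
    moreover have "finite {z \<in> G. (z, x) \<in> r}" "finite {z \<in> G. (x, z) \<in> r \<and> z \<noteq> x}"
      using finite_flag[OF G(1)] by simp_all
    ultimately show ?thesis
      using card_flag[OF G(1)] card_Un_disjoint by fastforce
  qed
  let ?G = "C \<union> {z \<in> F. (x, z) \<in> r}"
  have Cx: "(u, x) \<in> r" if "u \<in> C" for u
    using flag_total[OF C that that] by blast
  have "insert x C \<in> Chains (Restr r {z. (z, x) \<in> r})"
    using flags_subset_Chains[THEN subsetD, OF C] Cx xx by (auto simp: in_Chains_iff)
  then have "x \<in> C"
    using flag_maximal[OF C] by blast
  then have "{z \<in> ?G. (z, x) \<in> r} = C"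
    using Cx r_antisym by blast
  moreover have "{z \<in> ?G. (x, z) \<in> r \<and> z \<noteq> x} = ?U"
    using Cx r_antisym by blast
  moreover have "x \<in> ?G"
    using x xx by blast
  ultimately show ?thesis
    using split[OF replace_flag_below_face[OF F x C]] split[OF F x] by simp
qed

text \<open>The choice hidden in \<open>face_rank\<close> is harmless, as all flags below
  \<open>x\<close> have the same size. The rank can thus be read off any flag through
  \<open>x\<close>.\<close>

lemma face_rank_eq:
  assumes "F \<in> flags r" "x \<in> F"
  shows "face_rank r x = int (card {z \<in> F. (z, x) \<in> r}) - 2"
proof -
  let ?s = "Restr r {z. (z, x) \<in> r}"
  have "(SOME C. C \<in> flags ?s) \<in> flags ?s"
    using flag_below_face[OF assms] by (rule someI)
  from card_flag_below_face[OF assms this] show ?thesis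
    by (simp add: face_rank_def)
qed

lemma face_rank_strict_mono:
  assumes "(x, y) \<in> r" "x \<noteq> y"
  shows "face_rank r x < face_rank r y"
proof -
  obtain F where F: "F \<in> flags r" "x \<in> F" "y \<in> F"
    using assms(1) by (rule face_pair_in_flag)
  have "(y, y) \<in> r"
    using F flag_subset_Field r_refl by blast
  then have "{z \<in> F. (z, x) \<in> r} \<subset> {z \<in> F. (z, y) \<in> r}"
    using assms F r_trans r_antisym by blast
  then have "card {z \<in> F. (z, x) \<in> r} < card {z \<in> F. (z, y) \<in> r}"
    using finite_flag[OF F(1)] by (intro psubset_card_mono) auto
  then show ?thesis
    using F by (simp add: face_rank_eq)
qed

lemma flag_face_unique:
  assumes "F \<in> flags r" "x \<in> F" "y \<in> F" "face_rank r x = face_rank r y"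
  shows "x = y"
  using flag_total[OF assms(1-3)] face_rank_strict_mono[of x y] face_rank_strict_mono[of y x] assms(4)
  by (metis less_irrefl)

lemma flag_face_le:
  assumes "F \<in> flags r" "x \<in> F" "y \<in> F" "face_rank r x \<le> face_rank r y"
  shows "(x, y) \<in> r"
  using flag_total[OF assms(1-3)] face_rank_strict_mono[of y x] assms
  by (metis leD)

text \<open>The \<open>n + 2\<close> faces of a flag have distinct ranks in a range of
  \<open>n + 2\<close> integers, so every rank occurs.\<close>

lemma face_rank_image_flag:
  assumes F: "F \<in> flags r"
  shows "face_rank r ` F = {-1..int n}"
proof (rule card_subset_eq)
  show "face_rank r ` F \<subseteq> {-1..int n}"
  proof
    fix k assume "k \<in> face_rank r ` F"
    then obtain x where x: "x \<in> F" "k = face_rank r x" by blast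
    have "(x, x) \<in> r"
      using F x flag_subset_Field r_refl by blast
    then have "card {z \<in> F. (z, x) \<in> r} > 0"
      using x finite_flag[OF F] by (auto simp: card_gt_0_iff)
    moreover have "card {z \<in> F. (z, x) \<in> r} \<le> card F"
      using finite_flag[OF F] by (intro card_mono) auto
    ultimately show "k \<in> {-1..int n}"
      using x F by (simp add: face_rank_eq card_flag)
  qed
  have "inj_on (face_rank r) F"
    using flag_face_unique[OF F] by (auto intro: inj_onI)
  then show "card (face_rank r ` F) = card {-1..int n}"
    using F by (simp add: card_image card_flag)
qed simp

lemma flag_face_exists:
  assumes "F \<in> flags r" "-1 \<le> i" "i \<le> int n"
  obtains x where "x \<in> F" "face_rank r x = i"
proof -
  have "i \<in> face_rank r ` F"
    using assms by (simp add: face_rank_image_flag)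
  then show thesis using that by blast
qed

section \<open>Adjacent flags and the diamond condition\<close>

lemma diamond:
  assumes "(x, y) \<in> r" "face_rank r y = face_rank r x + 2"
  shows "card {z. (x, z) \<in> r \<and> (z, y) \<in> r \<and> z \<noteq> x \<and> z \<noteq> y} = 2"
  using polytope assms by (simp add: abstract_polytope_def)

text \<open>Pigeonhole: three faces of rank \<open>i\<close> between \<open>x\<close> and
  \<open>y\<close>, where the diamond condition allows only two. Both uniqueness and commutation of
  adjacent flags rest on this.\<close>

lemma flags_diamond:
  assumes "F \<in> flags r" "G \<in> flags r" "H \<in> flags r"
    and x: "x \<in> F" "x \<in> G" "x \<in> H" "face_rank r x = i - 1"
    and y: "y \<in> F" "y \<in> G" "y \<in> H" "face_rank r y = i + 1"
    and a: "a \<in> F" "face_rank r a = i" and b: "b \<in> G" "face_rank r b = i"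
    and c: "c \<in> H" "face_rank r c = i"
  shows "a = b \<or> b = c \<or> a = c"
proof -
  let ?Z = "{z. (x, z) \<in> r \<and> (z, y) \<in> r \<and> z \<noteq> x \<and> z \<noteq> y}"
  have "(x, y) \<in> r"
    using assms flag_face_le[OF assms(1)] by simp
  then have "card ?Z = 2"
    using x(4) y(4) by (intro diamond) simp_all
  then obtain u v where Z: "?Z = {u, v}"
    by (auto simp: card_2_iff)
  have mem: "z \<in> ?Z" if "K \<in> flags r" "x \<in> K" "y \<in> K" "z \<in> K" "face_rank r z = i" for K z
    using that x(4) y(4) by (auto intro: flag_face_le)
  have "a \<in> ?Z" "b \<in> ?Z" "c \<in> ?Z"
    using assms mem by blast+
  then show ?thesis
    unfolding Z by auto
qed

lemma agree_off_eqI: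
  assumes "F \<in> flags r" "G \<in> flags r" "agree_off r i F G"
    and "x \<in> F" "x \<in> G" "face_rank r x = i"
  shows "F = G"
proof -
  have "z \<in> F \<longleftrightarrow> z \<in> G" for z
    using assms flag_face_unique[of F z x] flag_face_unique[of G z x]
    by (cases "face_rank r z = i") (auto simp: agree_off_def)
  then show ?thesis by blast
qed

lemma adjacent_at_rank_iff:
  assumes F: "F \<in> flags r" and G: "G \<in> flags r"
  shows "adjacent F G \<and> (\<forall>x\<in>F - G. face_rank r x = i) \<longleftrightarrow> F \<noteq> G \<and> agree_off r i F G"
proof (intro iffI conjI)
  assume *: "adjacent F G \<and> (\<forall>x\<in>F - G. face_rank r x = i)"
  then show "F \<noteq> G"
    by (auto simp: adjacent_def)
  \<comment> \<open>The definition of \<open>adj_flag\<close> restricts only \<open>F - G\<close>. A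
    face of \<open>G - F\<close> of another rank has a counterpart of its rank in \<open>F\<close>;
    this lies in \<open>G\<close> too and would coincide with it.\<close>
  have "face_rank r y = i" if y: "y \<in> G - F" for y
  proof (rule ccontr)
    assume "face_rank r y \<noteq> i"
    have "face_rank r y \<in> face_rank r ` F"
      using y face_rank_image_flag[OF F] face_rank_image_flag[OF G] by blast
    then obtain z where z: "z \<in> F" "face_rank r z = face_rank r y"
      by auto
    then have "z \<in> G"
      using * \<open>face_rank r y \<noteq> i\<close> by (metis DiffI)
    then show False
      using z y flag_face_unique[OF G] by blast
  qed
  then show "agree_off r i F G"
    using * by (auto simp: agree_off_def)
next
  assume *: "F \<noteq> G \<and> agree_off r i F G"
  have one: "card (A - B) = 1"
    if A: "A \<in> flags r" and B: "B \<in> flags r" and ne: "A \<noteq> B" and off: "agree_off r i A B" for A B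
  proof -
    have "A - B \<noteq> {}"
      using flag_maximal[OF A] flags_subset_Chains B ne by blast
    then obtain x where x: "x \<in> A - B" by blast
    have rank: "face_rank r z = i" if "z \<in> A - B" for z
      using that off by (auto simp: agree_off_def)
    have "z = x" if "z \<in> A - B" for z
      using flag_face_unique[OF A, of z x] rank[OF that] rank[OF x] that x by simp
    then have "A - B = {x}"
      using x by blast
    then show ?thesis by simp
  qed
  show "adjacent F G"
    using one[OF F G] one[OF G F] * agree_off_sym by (auto simp: adjacent_def)
  show "\<forall>x\<in>F - G. face_rank r x = i"
    using * by (auto simp: agree_off_def)
qed

text \<open>The diamond around the face of rank \<open>i\<close> contains a second face, and
  swapping the two keeps a chain of full size. The bounds on \<open>i\<close> guarantee faces of
  ranks \<open>i - 1\<close> and \<open>i + 1\<close>.\<close>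

lemma agree_off_exists:
  assumes F: "F \<in> flags r" and i: "0 \<le> i" "i < int n"
  obtains G where "G \<in> flags r" "F \<noteq> G" "agree_off r i F G"
proof -
  obtain x where x: "x \<in> F" "face_rank r x = i - 1"
    using flag_face_exists[OF F, of "i - 1"] i by auto
  obtain y where y: "y \<in> F" "face_rank r y = i + 1"
    using flag_face_exists[OF F, of "i + 1"] i by auto
  obtain z where z: "z \<in> F" "face_rank r z = i"
    using flag_face_exists[OF F, of i] i by auto
  let ?Z = "{z. (x, z) \<in> r \<and> (z, y) \<in> r \<and> z \<noteq> x \<and> z \<noteq> y}"
  have "(x, y) \<in> r"
    using x y flag_face_le[OF F] by simp
  then have "card ?Z = 2"
    using x y by (intro diamond) simp_all
  then obtain w where w: "w \<in> ?Z" "w \<noteq> z"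
    by (auto simp: card_2_iff)
  have rank_w: "face_rank r w = i"
    using w x y face_rank_strict_mono[of x w] face_rank_strict_mono[of w y] by auto
  then have "w \<notin> F"
    using w z flag_face_unique[OF F] by blast
  let ?G = "insert w (F - {z})"
  \<comment> \<open>Every remaining face lies below \<open>x\<close> or above \<open>y\<close>,
    hence is comparable with \<open>w\<close> by transitivity.\<close>
  have comparable: "(u, w) \<in> r \<or> (w, u) \<in> r" if u: "u \<in> F - {z}" for u
  proof -
    have "face_rank r u \<noteq> i"
      using u z flag_face_unique[OF F] by blast
    then consider "face_rank r u \<le> face_rank r x" | "face_rank r y \<le> face_rank r u"
      using x y by linarith
    then show ?thesis
    proof cases
      case 1
      then have "(u, x) \<in> r"
        using u x flag_face_le[OF F] by blast
      then show ?thesis using w r_trans by blast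
    next
      case 2
      then have "(y, u) \<in> r"
        using u y flag_face_le[OF F] by blast
      then show ?thesis using w r_trans by blast
    qed
  qed
  have "(w, w) \<in> r"
    using w r_refl by (auto simp: Field_def)
  then have "?G \<in> Chains r"
    using comparable flag_total[OF F] by (auto simp: in_Chains_iff)
  moreover have "card ?G = n + 2"
    using \<open>w \<notin> F\<close> z finite_flag[OF F] card_flag[OF F] by (simp add: card_insert_disjoint)
  ultimately have "?G \<in> flags r"
    by (rule chain_card_flag)
  moreover have "F \<noteq> ?G"
    using \<open>w \<notin> F\<close> by blast
  moreover have "agree_off r i F ?G"
    using z rank_w by (auto simp: agree_off_def)
  ultimately show thesis
    by (rule that)
qed

lemma agree_off_unique:
  assumes F: "F \<in> flags r" and G: "G \<in> flags r" and H: "H \<in> flags r" and i: "0 \<le> i" "i < int n"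
    and FG: "F \<noteq> G" "agree_off r i F G" and FH: "F \<noteq> H" "agree_off r i F H"
  shows "G = H"
proof -
  obtain x where x: "x \<in> F" "face_rank r x = i - 1"
    using flag_face_exists[OF F, of "i - 1"] i by auto
  obtain y where y: "y \<in> F" "face_rank r y = i + 1"
    using flag_face_exists[OF F, of "i + 1"] i by auto
  obtain a where a: "a \<in> F" "face_rank r a = i"
    using flag_face_exists[OF F, of i] i by auto
  obtain b where b: "b \<in> G" "face_rank r b = i"
    using flag_face_exists[OF G, of i] i by auto
  obtain c where c: "c \<in> H" "face_rank r c = i"
    using flag_face_exists[OF H, of i] i by auto
  have "x \<in> G" "x \<in> H" "y \<in> G" "y \<in> H"
    using x y FG FH by (auto simp: agree_off_def)
  then have "a = b \<or> b = c \<or> a = c"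
    using flags_diamond[OF F G H] x y a b c by blast
  moreover have "a \<noteq> b" "a \<noteq> c"
    using agree_off_eqI[OF F G FG(2)] agree_off_eqI[OF F H FH(2)] FG FH a b c by blast+
  ultimately have "b = c" by blast
  moreover have "agree_off r i G H"
    using FG FH by (auto simp: agree_off_def)
  ultimately show ?thesis
    using agree_off_eqI[OF G H] b c by blast
qed

lemma adj_flag_unique:
  assumes "F \<in> flags r" "i < n" "G \<in> flags r" "F \<noteq> G" "agree_off r (int i) F G"
  shows "adj_flag r i F = G"
  unfolding adj_flag_def
proof (rule the_equality)
  show "G \<in> flags r \<and> adjacent F G \<and> (\<forall>x\<in>F - G. face_rank r x = int i)"
    using adjacent_at_rank_iff[OF assms(1,3)] assms by blast
  fix H assume "H \<in> flags r \<and> adjacent F H \<and> (\<forall>x\<in>F - H. face_rank r x = int i)"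
  then show "H = G"
    using adjacent_at_rank_iff[OF assms(1), of H] agree_off_unique[OF assms(1) _ assms(3), of H "int i"]
      assms by auto
qed

lemma
  assumes F: "F \<in> flags r" and i: "i < n"
  shows adj_flag_in_flags: "adj_flag r i F \<in> flags r"
    and adj_flag_neq: "F \<noteq> adj_flag r i F"
    and adj_flag_agree_off: "agree_off r (int i) F (adj_flag r i F)"
    and adjacent_adj_flag: "adjacent F (adj_flag r i F)"
proof -
  obtain G where "G \<in> flags r" "F \<noteq> G" "agree_off r (int i) F G"
    using agree_off_exists[OF F] i by (metis of_nat_0_le_iff of_nat_less_iff)
  then show "adj_flag r i F \<in> flags r" "F \<noteq> adj_flag r i F" "agree_off r (int i) F (adj_flag r i F)"
      "adjacent F (adj_flag r i F)"
    using adj_flag_unique[OF F i] adjacent_at_rank_iff[OF F] by blast+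
qed

lemma adj_flag_adj_flag:
  assumes "F \<in> flags r" "i < n"
  shows "adj_flag r i (adj_flag r i F) = F"
  by (rule adj_flag_unique[OF adj_flag_in_flags[OF assms] assms(2,1)
        adj_flag_neq[OF assms, symmetric] agree_off_sym[OF adj_flag_agree_off[OF assms]]])

text \<open>Faces whose ranks differ by at least 2 can be exchanged independently. The fourfold form
  is the one that the square of \<open>\<sigma>\<^sub>i \<dots> \<sigma>\<^sub>j\<close>
  produces.\<close>

lemma adj_flag_commute:
  assumes F: "F \<in> flags r" and ij: "i < n" "j < n" "i + 1 < j"
  shows "adj_flag r j (adj_flag r i (adj_flag r j (adj_flag r i F))) = F"
proof -
  define A where "A = adj_flag r i F"
  define B where "B = adj_flag r j A"
  define C where "C = adj_flag r i B"
  note adj = adj_flag_in_flags adj_flag_neq adj_flag_agree_off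
  have A: "A \<in> flags r" "F \<noteq> A" "agree_off r (int i) F A"
    unfolding A_def using adj[OF F ij(1)] by auto
  have B: "B \<in> flags r" "A \<noteq> B" "agree_off r (int j) A B"
    unfolding B_def using adj[OF A(1) ij(2)] by auto
  have C: "C \<in> flags r" "B \<noteq> C" "agree_off r (int i) B C"
    unfolding C_def using adj[OF B(1) ij(1)] by auto
  obtain x where x: "x \<in> F" "face_rank r x = int i - 1"
    using flag_face_exists[OF F, of "int i - 1"] ij by auto
  obtain y where y: "y \<in> F" "face_rank r y = int i + 1"
    using flag_face_exists[OF F, of "int i + 1"] ij by auto
  obtain f where f: "f \<in> F" "face_rank r f = int i"
    using flag_face_exists[OF F, of "int i"] ij by auto
  obtain a where a: "a \<in> A" "face_rank r a = int i"
    using flag_face_exists[OF A(1), of "int i"] ij by auto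
  obtain c where c: "c \<in> C" "face_rank r c = int i"
    using flag_face_exists[OF C(1), of "int i"] ij by auto
  \<comment> \<open>Changing the face of rank \<open>j\<close> leaves the faces of ranks \<open>i - 1\<close> and \<open>i + 1\<close> alone, so the faces of
    rank \<open>i\<close> of all four flags lie in one diamond.\<close>
  have "x \<in> A" "y \<in> A" "x \<in> C" "y \<in> C"
    using x y ij A(3) B(3) C(3) by (auto simp: agree_off_def)
  then have "f = a \<or> a = c \<or> f = c"
    using flags_diamond[OF F A(1) C(1)] x y f a c by blast
  moreover have "f \<noteq> a"
    using agree_off_eqI[OF F A(1,3)] A(2) f a by blast
  moreover have "a \<in> B"
    using a B(3) ij by (auto simp: agree_off_def)
  then have "a \<noteq> c"
    using agree_off_eqI[OF B(1) C(1,3)] C(2) a c by blast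
  ultimately have "f = c" by blast
  have off: "agree_off r (int j) F C"
    unfolding agree_off_def
  proof (intro allI impI)
    fix z assume z: "face_rank r z \<noteq> int j"
    show "z \<in> F \<longleftrightarrow> z \<in> C"
    proof (cases "face_rank r z = int i")
      case True
      then show ?thesis
        using flag_face_unique[OF F, of z f] flag_face_unique[OF C(1), of z f] f c \<open>f = c\<close> by auto
    next
      case False
      then show ?thesis
        using z A(3) B(3) C(3) by (auto simp: agree_off_def)
    qed
  qed
  \<comment> \<open>The face of rank \<open>j\<close> tells \<open>C\<close> from \<open>F\<close>:
    it was replaced in passing from \<open>A\<close> to \<open>B\<close> and does not return in
    \<open>C\<close>.\<close>
  obtain g where g: "g \<in> F" "face_rank r g = int j"
    using flag_face_exists[OF F, of "int j"] ij by auto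
  have "g \<in> A"
    using g A(3) ij by (auto simp: agree_off_def)
  then have "g \<notin> B"
    using agree_off_eqI[OF A(1) B(1,3)] B(2) g by blast
  then have "g \<notin> C"
    using g C(3) ij by (auto simp: agree_off_def)
  then have "C \<noteq> F"
    using g by blast
  then show ?thesis
    using adj_flag_unique[OF C(1) ij(2) F _ agree_off_sym[OF off]] by (simp add: A_def B_def C_def)
qed

section \<open>Connectedness and improper faces\<close>

lemma bottom_top:
  obtains b t where "b \<in> Field r" "t \<in> Field r"
    "\<And>x. x \<in> Field r \<Longrightarrow> (b, x) \<in> r" "\<And>x. x \<in> Field r \<Longrightarrow> (x, t) \<in> r"
proof -
  have "\<exists>b\<in>Field r. \<forall>x\<in>Field r. (b, x) \<in> r" "\<exists>t\<in>Field r. \<forall>x\<in>Field r. (x, t) \<in> r"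
    using polytope by (simp_all add: abstract_polytope_def)
  then show thesis using that by blast
qed

text \<open>The definition speaks of sections; the section from the least to the greatest face is
  the whole polytope.\<close>

lemma flag_connected: "flag_connected r"
proof -
  obtain b t where bt: "b \<in> Field r" "t \<in> Field r"
      "\<And>x. x \<in> Field r \<Longrightarrow> (b, x) \<in> r" "\<And>x. x \<in> Field r \<Longrightarrow> (x, t) \<in> r"
    using bottom_top by blast
  then have "section_between r b t = r"
    by (auto simp: section_between_def Field_def)
  moreover have "flag_connected (section_between r b t)"
    using polytope bt by (simp add: abstract_polytope_def)
  ultimately show ?thesis by simp
qed

text \<open>Adjacent flags never differ in an improper face.\<close>

lemma adjacent_imp_adj_flag:
  assumes F: "F \<in> flags r" and G: "G \<in> flags r" and "adjacent F G"
  obtains i where "i < n" "G = adj_flag r i F"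
proof -
  obtain x where x: "F - G = {x}"
    using assms(3) by (auto simp: adjacent_def card_1_singleton_iff)
  let ?k = "face_rank r x"
  have G_eq: "F \<noteq> G" "agree_off r ?k F G"
    using adjacent_at_rank_iff[OF F G, of ?k] assms(3) x by auto
  obtain b t where bt: "b \<in> Field r" "t \<in> Field r"
      "\<And>x. x \<in> Field r \<Longrightarrow> (b, x) \<in> r" "\<And>x. x \<in> Field r \<Longrightarrow> (x, t) \<in> r"
    using bottom_top by blast
  have "z \<in> H" if H: "H \<in> flags r" and z: "z = b \<or> z = t" for z H
  proof -
    have "insert z H \<in> Chains r"
      using z bt flag_subset_Field[OF H] flag_total[OF H] by (auto simp: in_Chains_iff)
    then show ?thesis
      using flag_maximal[OF H] by blast
  qed
  then have "x \<noteq> b" "x \<noteq> t" "b \<in> F" "t \<in> F"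
    using x F G by blast+
  moreover have "x \<in> F"
    using x by blast
  then have "x \<in> Field r"
    using flag_subset_Field[OF F] by blast
  ultimately have "face_rank r b < ?k" "?k < face_rank r t"
    using bt face_rank_strict_mono by blast+
  moreover have "face_rank r b \<in> {-1..int n}" "face_rank r t \<in> {-1..int n}"
    using \<open>b \<in> F\<close> \<open>t \<in> F\<close> face_rank_image_flag[OF F] by blast+
  ultimately have "0 \<le> ?k" "?k < int n"
    by auto
  then show thesis
    using that[of "nat ?k"] adj_flag_unique[OF F _ G, of "nat ?k"] G_eq by simp
qed

section \<open>The automorphism group and its action on flags\<close>

lemma aut_in_Bij: "f \<in> carrier (aut_group r) \<Longrightarrow> f \<in> Bij (Field r)"
  by (simp add: aut_group_def)

lemma aut_le_iff:
  "f \<in> carrier (aut_group r) \<Longrightarrow> x \<in> Field r \<Longrightarrow> y \<in> Field r \<Longrightarrow> (f x, f y) \<in> r \<longleftrightarrow> (x, y) \<in> r"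
  by (simp add: aut_group_def)

lemma aut_inj: "f \<in> carrier (aut_group r) \<Longrightarrow> inj_on f (Field r)"
  using aut_in_Bij by (auto simp: Bij_def bij_betw_def)

lemma aut_closed: "f \<in> carrier (aut_group r) \<Longrightarrow> x \<in> Field r \<Longrightarrow> f x \<in> Field r"
  using aut_in_Bij by (auto simp: Bij_def bij_betw_def)

lemma mult_aut_group:
  "f \<in> carrier (aut_group r) \<Longrightarrow> g \<in> carrier (aut_group r) \<Longrightarrow>
    f \<otimes>\<^bsub>aut_group r\<^esub> g = compose (Field r) f g"
  by (simp add: aut_group_def BijGroup_def)

lemma one_aut_group: "\<one>\<^bsub>aut_group r\<^esub> = (\<lambda>x\<in>Field r. x)"
  by (simp add: aut_group_def BijGroup_def)

lemma group_aut_group: "group (aut_group r)"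
proof -
  let ?A = "carrier (aut_group r)"
  interpret B: group "BijGroup (Field r)" by (rule group_BijGroup)
  have "subgroup ?A (BijGroup (Field r))"
  proof (rule subgroup.intro)
    show "?A \<subseteq> carrier (BijGroup (Field r))"
      by (auto simp: aut_group_def BijGroup_def)
    show "\<one>\<^bsub>BijGroup (Field r)\<^esub> \<in> ?A"
      by (simp add: aut_group_def BijGroup_def id_Bij)
    fix f assume f: "f \<in> ?A"
    then have bij: "f \<in> Bij (Field r)" by (rule aut_in_Bij)
    then have img: "f ` Field r = Field r"
      by (simp add: Bij_def bij_betw_def)
    let ?g = "\<lambda>x\<in>Field r. inv_into (Field r) f x"
    have g: "?g x \<in> Field r" "f (?g x) = x" if "x \<in> Field r" for x
      using that img inv_into_into[of x f "Field r"] f_inv_into_f[of x f "Field r"] by simp_all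
    have "(?g x, ?g y) \<in> r \<longleftrightarrow> (x, y) \<in> r" if "x \<in> Field r" "y \<in> Field r" for x y
      using aut_le_iff[OF f g(1)[OF that(1)] g(1)[OF that(2)]] g(2) that by metis
    moreover have "?g \<in> Bij (Field r)"
      using bij by (rule restrict_inv_into_Bij)
    ultimately show "inv\<^bsub>BijGroup (Field r)\<^esub> f \<in> ?A"
      unfolding inv_BijGroup[OF bij] by (simp add: aut_group_def)
    fix h assume h: "h \<in> ?A"
    then have "compose (Field r) f h \<in> Bij (Field r)"
      using bij aut_in_Bij by (intro compose_Bij)
    then show "f \<otimes>\<^bsub>BijGroup (Field r)\<^esub> h \<in> ?A"
      using bij aut_in_Bij[OF h] aut_le_iff[OF f] aut_le_iff[OF h] aut_closed[OF h]
      by (simp add: aut_group_def BijGroup_def compose_def)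
  qed
  then have "group (BijGroup (Field r)\<lparr>carrier := ?A\<rparr>)"
    by (rule B.subgroup_imp_group)
  then show ?thesis
    by (simp add: aut_group_def)
qed

lemma finite_aut_group: "finite (carrier (aut_group r))"
proof (rule finite_subset)
  show "carrier (aut_group r) \<subseteq> Field r \<rightarrow>\<^sub>E Field r"
    using aut_in_Bij by (auto simp: PiE_def Bij_imp_extensional intro: Bij_imp_funcset aut_closed)
qed (simp add: finite_PiE finite_Field)

lemma image_mult_aut_group:
  assumes "f \<in> carrier (aut_group r)" "g \<in> carrier (aut_group r)" "F \<subseteq> Field r"
  shows "(f \<otimes>\<^bsub>aut_group r\<^esub> g) ` F = f ` g ` F"
  using assms by (force simp: mult_aut_group compose_def)

lemma image_one_aut_group: "F \<subseteq> Field r \<Longrightarrow> \<one>\<^bsub>aut_group r\<^esub> ` F = F"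
  by (force simp: one_aut_group)

lemma aut_image_flag:
  assumes f: "f \<in> carrier (aut_group r)" and F: "F \<in> flags r"
  shows "f ` F \<in> flags r"
proof (rule chain_card_flag)
  show "f ` F \<in> Chains r"
    using flag_total[OF F] flag_subset_Field[OF F] aut_le_iff[OF f]
    by (auto simp: in_Chains_iff subset_eq)
  show "card (f ` F) = n + 2"
    using card_image[OF inj_on_subset[OF aut_inj[OF f] flag_subset_Field[OF F]]] card_flag[OF F]
    by simp
qed

text \<open>The rank of \<open>f x\<close> may be read off the image of a flag through
  \<open>x\<close>.\<close>

lemma aut_face_rank:
  assumes f: "f \<in> carrier (aut_group r)" and x: "x \<in> Field r"
  shows "face_rank r (f x) = face_rank r x"
proof -
  obtain F where F: "F \<in> flags r" "x \<in> F"
    using x by (rule face_in_flag)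
  have sub: "F \<subseteq> Field r"
    using F flag_subset_Field by blast
  have "{z \<in> f ` F. (z, f x) \<in> r} = f ` {z \<in> F. (z, x) \<in> r}"
    using aut_le_iff[OF f _ x] sub by auto
  moreover have "inj_on f {z \<in> F. (z, x) \<in> r}"
    using aut_inj[OF f] sub by (auto intro: inj_on_subset)
  ultimately show ?thesis
    using F face_rank_eq[OF aut_image_flag[OF f F(1)], of "f x"]
    by (simp add: face_rank_eq card_image)
qed

text \<open>Automorphisms preserve ranks, so the image of the \<open>i\<close>-adjacent flag is
  \<open>i\<close>-adjacent to the image of \<open>F\<close>; such a flag is unique.\<close>

lemma aut_image_adj_flag:
  assumes f: "f \<in> carrier (aut_group r)" and F: "F \<in> flags r" and i: "i < n"
  shows "f ` adj_flag r i F = adj_flag r i (f ` F)"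
proof -
  let ?G = "adj_flag r i F"
  note G = adj_flag_in_flags[OF F i] adj_flag_neq[OF F i] adj_flag_agree_off[OF F i]
  have sub: "F \<subseteq> Field r" "?G \<subseteq> Field r"
    using F G flag_subset_Field by blast+
  have "f ` F \<noteq> f ` ?G"
    using inj_on_image_eq_iff[OF aut_inj[OF f] sub] G(2) by blast
  moreover have "agree_off r (int i) (f ` F) (f ` ?G)"
    using G(3) sub aut_face_rank[OF f] unfolding agree_off_def by (auto simp: image_iff subset_eq)
  ultimately show ?thesis
    using adj_flag_unique[OF aut_image_flag[OF f F] i aut_image_flag[OF f G(1)]] by simp
qed

text \<open>Agreement on one flag spreads to adjacent flags and, by connectedness, to all. On a
  single face \<open>x\<close> in a flag \<open>G\<close>, both values are faces of equal rank in
  the image of \<open>G\<close>, hence equal.\<close>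

lemma aut_eqI:
  assumes f: "f \<in> carrier (aut_group r)" and g: "g \<in> carrier (aut_group r)"
    and F: "F \<in> flags r" and eq: "f ` F = g ` F"
  shows "f = g"
proof (rule extensionalityI)
  have all: "f ` G = g ` G" if G: "G \<in> flags r" for G
  proof -
    have "(F, G) \<in> {(A, B). A \<in> flags r \<and> B \<in> flags r \<and> adjacent A B}\<^sup>*"
      using flag_connected F G by (simp add: flag_connected_def)
    then show ?thesis
    proof induction
      case (step A B)
      then have "A \<in> flags r" "B \<in> flags r" "adjacent A B" by auto
      then obtain i where "i < n" "B = adj_flag r i A"
        by (rule adjacent_imp_adj_flag)
      then show ?case
        using step.IH \<open>A \<in> flags r\<close> by (simp add: aut_image_adj_flag f g)
    qed (rule eq)
  qed
  show "f \<in> extensional (Field r)" "g \<in> extensional (Field r)"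
    using f g aut_in_Bij Bij_imp_extensional by blast+
  fix x assume x: "x \<in> Field r"
  then obtain G where G: "G \<in> flags r" "x \<in> G"
    by (rule face_in_flag)
  then have "f x \<in> f ` G" "g x \<in> f ` G"
    using all by blast+
  then show "f x = g x"
    using flag_face_unique[OF aut_image_flag[OF f G(1)]] x by (simp add: aut_face_rank f g)
qed

text \<open>The orbit relation gives existence and \<open>aut_eqI\<close> uniqueness, so the
  description in \<open>aut_moving\<close> denotes.\<close>

lemma aut_moving_props:
  assumes "F \<in> flags r" "(F, G) \<in> flag_orbit_rel r"
  shows "aut_moving r F G \<in> carrier (aut_group r)" "aut_moving r F G ` F = G"
proof -
  have "\<exists>!f. f \<in> carrier (aut_group r) \<and> f ` F = G"
    using assms aut_eqI[OF _ _ assms(1)] by (auto simp: flag_orbit_rel_def)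
  from theI'[OF this] show "aut_moving r F G \<in> carrier (aut_group r)" "aut_moving r F G ` F = G"
    by (simp_all add: aut_moving_def)
qed

section \<open>Flag orbits and the standard rotations\<close>

lemma equiv_flag_orbit_rel: "equiv (flags r) (flag_orbit_rel r)"
proof -
  interpret A: group "aut_group r" by (rule group_aut_group)
  show ?thesis
  proof (rule equivI)
    show "refl_on (flags r) (flag_orbit_rel r)"
      using image_one_aut_group flag_subset_Field
      by (auto simp: refl_on_def flag_orbit_rel_def intro!: bexI[OF _ A.one_closed])
    show "sym (flag_orbit_rel r)"
    proof (rule symI)
      fix F G assume "(F, G) \<in> flag_orbit_rel r"
      then obtain f where f: "F \<in> flags r" "G \<in> flags r" "f \<in> carrier (aut_group r)" "f ` F = G"
        by (auto simp: flag_orbit_rel_def)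
      then have "(inv\<^bsub>aut_group r\<^esub> f) ` G = F"
        using image_mult_aut_group[of "inv\<^bsub>aut_group r\<^esub> f" f F]
        by (simp add: image_one_aut_group flag_subset_Field)
      then show "(G, F) \<in> flag_orbit_rel r"
        using f A.inv_closed by (auto simp: flag_orbit_rel_def)
    qed
    show "trans (flag_orbit_rel r)"
    proof (rule transI)
      fix F G H assume "(F, G) \<in> flag_orbit_rel r" "(G, H) \<in> flag_orbit_rel r"
      then obtain f g where fg: "F \<in> flags r" "H \<in> flags r" "f \<in> carrier (aut_group r)"
          "g \<in> carrier (aut_group r)" "g ` f ` F = H"
        by (auto simp: flag_orbit_rel_def)
      then have "(g \<otimes>\<^bsub>aut_group r\<^esub> f) ` F = H"
        by (simp add: image_mult_aut_group flag_subset_Field)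
      then show "(F, H) \<in> flag_orbit_rel r"
        using fg A.m_closed by (auto simp: flag_orbit_rel_def)
    qed
  qed (auto simp: flag_orbit_rel_def)
qed

text \<open>Each step to an adjacent flag changes the orbit, and there are only two orbits, so two
  steps lead back. This yields the standard rotations in the chiral case.\<close>

lemma chiral_orbit_adj_adj:
  assumes "chiral r" "F \<in> flags r" "i < n" "j < n"
  shows "(F, adj_flag r j (adj_flag r i F)) \<in> flag_orbit_rel r"
proof -
  let ?G = "adj_flag r i F"
  let ?H = "adj_flag r j ?G"
  let ?E = "flag_orbit_rel r"
  have G: "?G \<in> flags r" and H: "?H \<in> flags r"
    using assms adj_flag_in_flags by auto
  have "(F, ?G) \<notin> ?E" "(?G, ?H) \<notin> ?E"
    using assms G H adjacent_adj_flag by (auto simp: chiral_def)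
  then have "?E `` {F} \<noteq> ?E `` {?G}" "?E `` {?G} \<noteq> ?E `` {?H}"
    using eq_equiv_class_iff[OF equiv_flag_orbit_rel] assms(2) G H by blast+
  moreover obtain X Y where "flags r // ?E = {X, Y}"
    using assms(1) by (auto simp: chiral_def card_2_iff)
  then have "?E `` {F} \<in> {X, Y}" "?E `` {?G} \<in> {X, Y}" "?E `` {?H} \<in> {X, Y}"
    using quotientI[OF assms(2), of ?E] quotientI[OF G, of ?E] quotientI[OF H, of ?E] by simp_all
  ultimately have "?E `` {F} = ?E `` {?H}"
    by (metis insertE singletonD)
  then show ?thesis
    using eq_equiv_class_iff[OF equiv_flag_orbit_rel assms(2) H] by blast
qed

text \<open>Both branches of \<open>rotation\<close> get the same description. In the regular case
  \<open>\<rho>\<^sub>i\<close> takes \<open>F\<close> to its \<open>i\<close>-adjacent flag, and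
  \<open>\<rho>\<^sub>i\<^sub>-\<^sub>1\<close>, applied next, commutes with passing to
  \<open>i\<close>-adjacent flags.\<close>

lemma
  assumes reg: "chiral r \<or> regular r" and F: "F \<in> flags r" and i: "1 \<le> i" "i < n"
  shows rotation_in_aut_group: "rotation r F i \<in> carrier (aut_group r)"
    and rotation_image_flag: "rotation r F i ` F = adj_flag r i (adj_flag r (i - 1) F)"
proof -
  interpret A: group "aut_group r" by (rule group_aut_group)
  have i': "i - 1 < n" using i by simp
  have "rotation r F i \<in> carrier (aut_group r) \<and>
      rotation r F i ` F = adj_flag r i (adj_flag r (i - 1) F)"
  proof (cases "regular r")
    case True
    have refl: "reflection r F k \<in> carrier (aut_group r)" "reflection r F k ` F = adj_flag r k F"
      if "k < n" for k
      using True F adj_flag_in_flags[OF F that] aut_moving_props[OF F]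
      by (auto simp: regular_def reflection_def)
    then show ?thesis
      using True refl[OF i'] refl[OF i(2)] F i
      by (simp add: rotation_def image_mult_aut_group flag_subset_Field aut_image_adj_flag)
  next
    case False
    then have "chiral r" using reg by blast
    from aut_moving_props[OF F chiral_orbit_adj_adj[OF this F i' i(2)]] show ?thesis
      using False by (simp add: rotation_def)
  qed
  then show "rotation r F i \<in> carrier (aut_group r)"
      "rotation r F i ` F = adj_flag r i (adj_flag r (i - 1) F)" by auto
qed

text \<open>Telescoping, by induction on \<open>i\<close> downwards from \<open>j\<close>. The
  rotation \<open>\<sigma>\<^sub>i\<close> commutes with adjacency and brings in the
  \<open>i\<close>-adjacent flag of the \<open>(i-1)\<close>-adjacent one; the two passages at rank
  \<open>i\<close> then cancel.\<close>

lemma word_eval_rotation_word: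
  assumes reg: "chiral r \<or> regular r" and F: "F \<in> flags r" and "1 \<le> i" "i \<le> j" "j < n"
  shows "word_eval (aut_group r) (rotation r F) (rotation_word i j) \<in> carrier (aut_group r) \<and>
    word_eval (aut_group r) (rotation r F) (rotation_word i j) ` F
      = adj_flag r j (adj_flag r (i - 1) F)"
  using assms(4,3)
proof (induction rule: inc_induct)
  case base
  interpret A: group "aut_group r" by (rule group_aut_group)
  show ?case
    using rotation_in_aut_group[OF reg F base(1) assms(5)] rotation_image_flag[OF reg F base(1) assms(5)]
    by (simp add: rotation_word_def)
next
  case (step i)
  interpret A: group "aut_group r" by (rule group_aut_group)
  let ?e = "word_eval (aut_group r) (rotation r F) (rotation_word (Suc i) j)"
  have i: "1 \<le> i" "i < n" "i - 1 < n"
    using step assms(5) by auto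
  have e: "?e \<in> carrier (aut_group r)" "?e ` F = adj_flag r j (adj_flag r i F)"
    using step.IH by auto
  note s = rotation_in_aut_group[OF reg F i(1,2)]
  note adj = adj_flag_in_flags[OF F i(2)] adj_flag_in_flags[OF F i(3)]
  have "rotation r F i ` ?e ` F = adj_flag r j (adj_flag r i (rotation r F i ` F))"
    by (simp add: e(2) aut_image_adj_flag[OF s] F adj i assms(5))
  also have "\<dots> = adj_flag r j (adj_flag r (i - 1) F)"
    by (simp only: rotation_image_flag[OF reg F i(1,2)] adj_flag_adj_flag[OF adj(2) i(2)])
  finally show ?case
    using e(1) s step.hyps
    by (simp add: rotation_word_Cons image_mult_aut_group flag_subset_Field[OF F])
qed

text \<open>The square of \<open>\<sigma>\<^sub>i \<dots> \<sigma>\<^sub>j\<close> fixes the base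
  flag and is therefore trivial. The condition \<open>i < j\<close> puts the ranks
  \<open>i - 1\<close> and \<open>j\<close> at distance at least 2, as
  \<open>adj_flag_commute\<close> requires.\<close>

lemma rotation_satisfies_Wplus_relations:
  assumes reg: "chiral r \<or> regular r" and F: "F \<in> flags r"
  shows "satisfies_Wplus_relations n (aut_group r) (rotation r F)"
  unfolding satisfies_Wplus_relations_def
proof (intro conjI allI impI)
  show "rotation r F \<in> {1..<n} \<rightarrow> carrier (aut_group r)"
    using rotation_in_aut_group[OF reg F] by auto
  interpret A: group "aut_group r" by (rule group_aut_group)
  fix i j assume ij: "1 \<le> i \<and> i < j \<and> j < n"
  let ?e = "word_eval (aut_group r) (rotation r F) (rotation_word i j)"
  have i: "i - 1 < n" "j < n"
    using ij by auto
  have e: "?e \<in> carrier (aut_group r)" "?e ` F = adj_flag r j (adj_flag r (i - 1) F)"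
    using word_eval_rotation_word[OF reg F, of i j] ij by auto
  have "?e ` ?e ` F = adj_flag r j (adj_flag r (i - 1) (?e ` F))"
    by (simp only: e(2) aut_image_adj_flag[OF e(1)] F i adj_flag_in_flags)
  also have "\<dots> = F"
    unfolding e(2) using ij i by (intro adj_flag_commute[OF F]) auto
  finally have "(?e \<otimes>\<^bsub>aut_group r\<^esub> ?e) ` F = \<one>\<^bsub>aut_group r\<^esub> ` F"
    by (simp add: image_mult_aut_group image_one_aut_group e(1) flag_subset_Field[OF F])
  then show "?e \<otimes>\<^bsub>aut_group r\<^esub> ?e = \<one>\<^bsub>aut_group r\<^esub>"
    using e(1) by (intro aut_eqI[OF _ _ F]) simp_all
qed

lemma
  assumes reg: "chiral r \<or> regular r" and F: "F \<in> flags r"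
  shows group_rotation_group: "group (rotation_group n r F)"
    and finite_rotation_group: "finite (carrier (rotation_group n r F))"
    and rotation_group_satisfies_Wplus_relations:
      "satisfies_Wplus_relations n (rotation_group n r F) (rotation r F)"
proof -
  interpret A: group "aut_group r" by (rule group_aut_group)
  let ?I = "generate (aut_group r) (rotation r F ` {1..<n})"
  have "rotation r F ` {1..<n} \<subseteq> carrier (aut_group r)"
    using rotation_in_aut_group[OF reg F] by auto
  then have sg: "subgroup ?I (aut_group r)"
    by (rule A.generate_is_subgroup)
  then show "group (rotation_group n r F)"
    unfolding rotation_group_def by (rule A.subgroup_imp_group)
  show "finite (carrier (rotation_group n r F))"
    using finite_subset[OF subgroup.subset[OF sg] finite_aut_group] by (simp add: rotation_group_def)
  show "satisfies_Wplus_relations n (rotation_group n r F) (rotation r F)"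
    unfolding rotation_group_def
    by (rule satisfies_Wplus_relations_subgroup[OF group_aut_group
          rotation_satisfies_Wplus_relations[OF reg F] sg]) (auto intro: generate.incl)
qed

end

theorem theorem4p4:
  fixes n :: nat and P :: "'a rel" and Q :: "'b rel"
    and \<Phi> :: "'a set" and \<Psi> :: "'b set" and g1 g2 :: nat
  assumes "abstract_polytope n P" and "finite (Field P)" and "\<Phi> \<in> flags P"
    and "chiral P \<or> directly_regular n P \<Phi>"
    and "abstract_polytope n Q" and "finite (Field Q)" and "\<Psi> \<in> flags Q"
    and "chiral Q \<or> directly_regular n Q \<Psi>"
    and "g1 = gcd (order (chirality_group n (rotations n P \<Phi>))) (order (rotation_group n Q \<Psi>))"
    and "g2 = gcd (order (chirality_group n (rotations n Q \<Psi>))) (order (rotation_group n P \<Phi>))"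
  shows "order (chirality_group n (rotations n P \<Phi>)) div g1
           dvd order (chirality_group n (mix n (rotations n P \<Phi>) (rotations n Q \<Psi>)))
       \<and> order (chirality_group n (rotations n Q \<Psi>)) div g2
           dvd order (chirality_group n (mix n (rotations n P \<Phi>) (rotations n Q \<Psi>)))"
proof -
  interpret P: finite_polytope n P by (rule finite_polytope.intro) fact+
  interpret Q: finite_polytope n Q by (rule finite_polytope.intro) fact+
  have P: "chiral P \<or> regular P" and Q: "chiral Q \<or> regular Q"
    using assms(4,8) by (auto simp: directly_regular_def)
  note rotation_groups =
    P.group_rotation_group[OF P assms(3)] Q.group_rotation_group[OF Q assms(7)]
    P.rotation_group_satisfies_Wplus_relations[OF P assms(3)]
    Q.rotation_group_satisfies_Wplus_relations[OF Q assms(7)]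
    P.finite_rotation_group[OF P assms(3)] Q.finite_rotation_group[OF Q assms(7)]
  show ?thesis
    unfolding assms(9,10) rotations_def
    using order_chirality_group_mix_dvd[OF rotation_groups] by blast
qed

end
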